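(* There exist a set $X$ and a group $G$ acting sharply $3$-transitively on $X$ such that for $x\in X$ the point stabilizer $G_x$ of $x$ has no nontrivial abelian normal subgroup.
   Context: An action of a group $G$ on a set $X$ with at least three points is sharply $3$-transitive if for any two ordered triples $(x_1,x_2,x_3)$, $(y_1,y_2,y_3)$ of pairwise distinct points of $X$ there is exactly one $g\in G$ with $x_ig=y_i$ for $i=1,2,3$. The conclusion is about every $x\in X$. *)

theory Defs
  imports "HOL-Algebra.Algebra"
begin

text \<open>
  Library group actions are left actions. A right action \<open>x g\<close> corresponds to the left action
  \<open>\<phi> g x = x g\<^sup>-\<^sup>1\<close>; unique existence of \<open>g\<close> below and the point stabilizers are the same for both.
\<close>

locale sharply_3_transitive_action = group_action +
  assumes three_points: "\<exists>a \<in> E. \<exists>b \<in> E. \<exists>c \<in> E. distinct [a, b, c]"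
    and sharply_3_transitive:
      "\<lbrakk> {x1, x2, x3} \<subseteq> E; distinct [x1, x2, x3]; {y1, y2, y3} \<subseteq> E; distinct [y1, y2, y3] \<rbrakk> \<Longrightarrow>
       \<exists>!g. g \<in> carrier G \<and> \<phi> g x1 = y1 \<and> \<phi> g x2 = y2 \<and> \<phi> g x3 = y3"

definition has_nontrivial_abelian_normal_subgroup :: "('a, 'b) monoid_scheme \<Rightarrow> bool" where
  "has_nontrivial_abelian_normal_subgroup H \<longleftrightarrow>
     (\<exists>N. N \<lhd> H \<and> comm_group (H\<lparr>carrier := N\<rparr>) \<and> N \<noteq> {\<one>\<^bsub>H\<^esub>})"

end

theory Submission
  imports Defs "HOL-Library.Countable"
begin

text \<open>
  Let the dihedral group of order 6, generated by \<open>flip\<close> and \<open>turn\<close>, act on a three-point base and on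
  infinitely many regular orbits. The sharply 3-transitive group is generated by it and by generic
  permutations, each of which is free of relations, except that it may commute with \<open>flip\<close> or with
  \<open>turn\<close>. The latter is forced: the setwise stabilizer of a triple in the final group is conjugate to
  the dihedral group, so if a triple is stable under exactly \<open>flip\<close> (or \<open>turn\<close>) at some time, then a
  permutation carrying the base to it can be chosen to centralize this element.

  The generators are approximated by finite partial permutations under two invariants: a word that
  fixes three points is trivial, and every triple can be moved to the base or to a triple whose
  setwise stabilizer is generated by the identity, \<open>flip\<close> or \<open>turn\<close>. They survive the addition of a
  new generator from the base to a triple outside its orbit, and the extension of a generator at a
  new point by a value in an untouched orbit.

  Every involution of the limit group with a fixed point is conjugate to \<open>flip\<close> and has only this
  fixed point. Hence an abelian normal subgroup of a point stabilizer would contain all involutions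
  of the stabilizer, but the construction can be started so that two of them do not commute.
\<close>

subsection \<open>The dihedral action\<close>

datatype c3 = C0 | C1 | C2

fun rot :: "c3 \<Rightarrow> c3" where "rot C0 = C1" | "rot C1 = C2" | "rot C2 = C0"
fun neg :: "c3 \<Rightarrow> c3" where "neg C0 = C0" | "neg C1 = C2" | "neg C2 = C1"

text \<open>
  \<open>F n b c\<close> is the element \<open>turn^c flip^b\<close> of the \<open>n\<close>-th regular orbit, \<open>B c\<close> the coset of \<open>turn^c\<close>
  modulo \<open>flip\<close>.
\<close>

datatype pt = B c3 | F nat bool c3

instance c3 :: countable by countable_datatype
instance pt :: countable by countable_datatype

fun turn :: "pt \<Rightarrow> pt" where
  "turn (B c) = B (rot c)" | "turn (F n b c) = F n b (rot c)"

fun flip :: "pt \<Rightarrow> pt" where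
  "flip (B c) = B (neg c)" | "flip (F n b c) = F n (\<not> b) (neg c)"

lemma turn3 [simp]: "turn (turn (turn x)) = x"
  by (cases x; cases "case x of B c \<Rightarrow> c | F n b c \<Rightarrow> c") auto

lemma flip2 [simp]: "flip (flip x) = x"
  by (cases x; cases "case x of B c \<Rightarrow> c | F n b c \<Rightarrow> c") auto

lemma flip_turn [simp]: "flip (turn x) = turn (turn (flip x))"
  by (cases x; cases "case x of B c \<Rightarrow> c | F n b c \<Rightarrow> c") auto

lemma turn_neq [simp]: "turn x \<noteq> x" "turn (turn x) \<noteq> x"
  by (cases x; cases "case x of B c \<Rightarrow> c | F n b c \<Rightarrow> c"; auto)+

lemma flip_fixed [simp]: "flip x = x \<longleftrightarrow> x = B C0"
  by (cases x; cases "case x of B c \<Rightarrow> c | F n b c \<Rightarrow> c") auto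

lemma turn_inject [simp]: "turn x = turn y \<longleftrightarrow> x = y"
  by (metis turn3)

lemma flip_inject [simp]: "flip x = flip y \<longleftrightarrow> x = y"
  by (metis flip2)

definition dih :: "(pt \<Rightarrow> pt) set" where
  "dih = {id, turn, turn \<circ> turn, flip, turn \<circ> flip, turn \<circ> turn \<circ> flip}"

lemma dih_comp: "f \<in> dih \<Longrightarrow> g \<in> dih \<Longrightarrow> f \<circ> g \<in> dih"
  unfolding dih_def by (auto simp: fun_eq_iff)

lemma dih_inverse: "f \<in> dih \<Longrightarrow> \<exists>g \<in> dih. g \<circ> f = id \<and> f \<circ> g = id"
  unfolding dih_def by (auto simp: fun_eq_iff)

lemma dih_inj: "f \<in> dih \<Longrightarrow> f x = f y \<longleftrightarrow> x = y"
  unfolding dih_def by auto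

lemma dih_free: "f \<in> dih \<Longrightarrow> g \<in> dih \<Longrightarrow> f (F n b c) = g (F n b c) \<Longrightarrow> f = g"
  unfolding dih_def by (cases c; auto)

definition base :: "pt set" where "base = {B C0, B C1, B C2}"

lemma card_base [simp]: "card base = 3" "finite base"
  by (auto simp: base_def)

lemma B_in_base [simp]: "B c \<in> base"
  by (cases c) (auto simp: base_def)

lemma F_notin_base [simp]: "F n b c \<notin> base"
  by (auto simp: base_def)

lemma dih_base: "f \<in> dih \<Longrightarrow> x \<in> base \<Longrightarrow> f x \<in> base"
  unfolding dih_def base_def by auto

lemma dih_base_faithful: "f \<in> dih \<Longrightarrow> \<forall>x\<in>base. f x = x \<Longrightarrow> f = id"
  unfolding dih_def base_def by auto

text \<open>On the base the dihedral group is the full symmetric group, so transitivity on ordered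
  triples follows once every triple can be moved onto the base.\<close>

lemma dih_base_realize:
  assumes "distinct [a1, a2, a3]" "a1 \<in> base" "a2 \<in> base" "a3 \<in> base"
  shows "\<exists>f \<in> dih. f (B C0) = a1 \<and> f (B C1) = a2 \<and> f (B C2) = a3"
  using assms unfolding dih_def base_def by auto

section \<open>Cyclic subgroups of the dihedral group and their kinds\<close>

datatype kind = Triv | Refl | Rota

instance kind :: countable by countable_datatype

fun act :: "kind \<Rightarrow> pt \<Rightarrow> pt" where
  "act Triv = id" | "act Refl = flip" | "act Rota = turn"

fun cyc :: "kind \<Rightarrow> (pt \<Rightarrow> pt) set" where
  "cyc Triv = {id}" | "cyc Refl = {id, flip}" | "cyc Rota = {id, turn, turn \<circ> turn}"

lemma cyc_dih: "h \<in> cyc k \<Longrightarrow> h \<in> dih"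
  by (cases k) (auto simp: dih_def)

lemma cyc_act: "act k \<in> cyc k" by (cases k) auto

lemma cyc_id: "id \<in> cyc k" by (cases k) auto

lemma cyc_comp: "h \<in> cyc k \<Longrightarrow> h' \<in> cyc k \<Longrightarrow> h \<circ> h' \<in> cyc k"
  by (cases k) (auto simp: fun_eq_iff)

lemma cyc_inverse: "h \<in> cyc k \<Longrightarrow> \<exists>h' \<in> cyc k. h' \<circ> h = id \<and> h \<circ> h' = id"
  by (cases k) (auto simp: fun_eq_iff)

text \<open>Nontrivial rotations have no fixed point and \<open>flip\<close> fixes only
  \<open>B C0\<close>. This later makes equivariant extensions well defined.\<close>

lemma cyc_free:
  "h \<in> cyc k \<Longrightarrow> h' \<in> cyc k \<Longrightarrow> h x = h' x \<Longrightarrow> (k = Refl \<Longrightarrow> x \<noteq> B C0) \<Longrightarrow> h = h'"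
  by (cases k) (auto simp: eq_commute[of x])

lemma cyc_commute:
  assumes "\<And>x. act k (f x) = f (act k x)" "h \<in> cyc k"
  shows "h (f x) = f (h x)"
  using assms by (cases k) auto

text \<open>
  Apart from the base, no triple is stable under the whole dihedral group, as the other orbits are
  regular; a proper nontrivial subgroup is conjugate to the one generated by the flip or the turn.
\<close>

lemma dih_stabilizer:
  assumes "card T = 3" "T \<noteq> base"
  obtains h k where "h \<in> dih" "act k ` h ` T \<subseteq> h ` T"
    "\<And>u. u \<in> dih \<Longrightarrow> u ` h ` T \<subseteq> h ` T \<Longrightarrow> u \<in> cyc k"
proof -
  note stab = that
  \<comment> \<open>A regular orbit has six points, too many for a triple; so a triple stable under
    both generators lies in the base and hence equals it.\<close>
  have no: "\<not> (turn ` U \<subseteq> U \<and> flip ` U \<subseteq> U)" if "card U = 3" "U \<noteq> base" for U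
  proof
    assume a: "turn ` U \<subseteq> U \<and> flip ` U \<subseteq> U"
    have fin: "finite U" using that by (metis card.infinite zero_neq_numeral)
    have "x \<in> base" if "x \<in> U" for x
    proof (rule ccontr)
      assume "x \<notin> base"
      then obtain n b c where x: "x = F n b c" by (cases x) auto
      have *: "f x \<in> U" if "f \<in> dih" for f using that a \<open>x \<in> U\<close> unfolding dih_def by (auto simp: image_subset_iff)
      have "(\<lambda>f. f x) ` dih \<subseteq> U" using * by auto
      moreover have "inj_on (\<lambda>f. f x) dih" using dih_free x by (auto simp: inj_on_def)
      moreover have "{F n b c | b c. True} \<subseteq> (\<lambda>f. f x) ` dih"
        by (cases b; cases c; auto simp: dih_def x image_iff; metis (full_types) c3.exhaust)
      ultimately have "{F n b c | b c. True} \<subseteq> U" by blast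
      moreover have "{F n True C0, F n True C1, F n True C2, F n False C0} \<subseteq> {F n b c | b c. True}" by auto
      ultimately have "card {F n True C0, F n True C1, F n True C2, F n False C0} \<le> card U"
        by (meson card_mono fin subset_trans)
      then show False using that \<open>card U = 3\<close> by auto
    qed
    then have "U \<subseteq> base" by auto
    then show False using that by (metis card_base card_subset_eq)
  qed
  have fin: "finite T" using assms by (metis card.infinite zero_neq_numeral)
  have iter: "turn ` U \<subseteq> U" if "(turn \<circ> turn) ` U \<subseteq> U" for U
  proof
    fix y assume "y \<in> turn ` U"
    then obtain x where x: "x \<in> U" "y = turn x" by auto
    then have "turn (turn x) \<in> U" using that by auto
    then have "turn (turn (turn (turn x))) \<in> U" using that by auto
    then show "y \<in> U" using x by simp
  qed
  have flipcase: thesis if h: "h \<in> dih" and f: "flip ` h ` T \<subseteq> h ` T" for h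
  proof (rule stab[OF h, of Refl])
    show "act Refl ` h ` T \<subseteq> h ` T" using f by simp
    fix u assume u: "u \<in> dih" "u ` h ` T \<subseteq> h ` T"
    let ?U = "h ` T"
    have c: "card ?U = 3" using assms(1) dih_inj[OF h] by (subst card_image) (auto simp: inj_on_def)
    have "?U \<noteq> base"
    proof
      assume a: "?U = base"
      obtain g where g: "g \<in> dih" "g \<circ> h = id" using dih_inverse[OF h] by auto
      have "T = g ` ?U" using g by (simp add: image_comp)
      then have "T \<subseteq> base" using dih_base[OF g(1)] a by auto
      then show False using assms by (metis card_base card_subset_eq)
    qed
    then have nt: "\<not> turn ` ?U \<subseteq> ?U" using no c f by blast
    \<comment> \<open>If \<open>u\<close> is a reflection other than \<open>flip\<close>, then
      \<open>u \<circ> flip\<close> is a nontrivial rotation, which \<open>nt\<close>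
      excludes.\<close>
    have "(u \<circ> flip) ` ?U \<subseteq> ?U" using u f by (auto simp: image_subset_iff)
    then show "u \<in> cyc Refl" using u nt iter[of ?U] unfolding dih_def
      by (auto simp: image_subset_iff)
  qed
  show thesis
  proof (cases "turn ` T \<subseteq> T")
    case True
    have nf: "\<not> flip ` T \<subseteq> T" using no assms True by blast
    show thesis
    proof (rule stab[of id Rota])
      show "id \<in> dih" by (simp add: dih_def)
      show "act Rota ` id ` T \<subseteq> id ` T" using True by simp
      fix u assume u: "u \<in> dih" "u ` id ` T \<subseteq> id ` T"
      have "turn y \<in> T" if "y \<in> T" for y using True that by auto
      have "(turn \<circ> u) ` T \<subseteq> T" "(turn \<circ> turn \<circ> u) ` T \<subseteq> T" using u True by (auto simp: image_subset_iff)
      then show "u \<in> cyc Rota" using u nf unfolding dih_def by (auto simp: image_subset_iff)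
    qed
  next
    case nt: False
    \<comment> \<open>A nontrivial rotation in the stabilizer would make \<open>turn\<close>
      stabilize \<open>T\<close>, so only the three reflections are left.\<close>
    consider "flip ` T \<subseteq> T" | "(turn \<circ> flip) ` T \<subseteq> T" | "(turn \<circ> turn \<circ> flip) ` T \<subseteq> T"
      | "\<And>u. u \<in> dih \<Longrightarrow> u ` T \<subseteq> T \<Longrightarrow> u = id"
      using nt iter[of T] unfolding dih_def by blast
    then show thesis
    proof cases
      case 1
      then show thesis using flipcase[of id] by (simp add: dih_def)
    next
      case 2
      \<comment> \<open>Conjugation by \<open>turn\<close> takes \<open>turn \<circ> flip\<close> to
        \<open>flip\<close>; in the next case conjugation by \<open>turn \<circ> turn\<close> does
        this for \<open>turn \<circ> turn \<circ> flip\<close>.\<close>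
      then show thesis using flipcase[of turn] by (auto simp: dih_def image_subset_iff)
    next
      case 3
      have "flip ` (turn \<circ> turn) ` T \<subseteq> (turn \<circ> turn) ` T"
      proof
        fix y assume "y \<in> flip ` (turn \<circ> turn) ` T"
        then obtain x where x: "x \<in> T" "y = flip (turn (turn x))" by auto
        then have "(turn \<circ> turn \<circ> flip) x \<in> T" using 3 by blast
        moreover have "y = (turn \<circ> turn) ((turn \<circ> turn \<circ> flip) x)" using x by simp
        ultimately show "y \<in> (turn \<circ> turn) ` T" by (rule rev_image_eqI)
      qed
      then show thesis using flipcase[of "turn \<circ> turn"] by (simp add: dih_def)
    next
      case 4
      then show thesis using stab[of id Triv] by (auto simp: dih_def)
    qed
  qed
qed

subsection \<open>Words in partial permutations\<close>

declare split_paired_All [simp del]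

text \<open>The kind prescribes the element with which the generator commutes; the number supplies
  infinitely many generators of each kind.\<close>

type_synonym gen = "kind \<times> nat"
type_synonym partial = "gen \<Rightarrow> (pt \<times> pt) set"

datatype letter = Fl | Tu | Ge gen bool

fun step :: "partial \<Rightarrow> letter \<Rightarrow> pt \<Rightarrow> pt \<Rightarrow> bool" where
  "step P Fl x y \<longleftrightarrow> y = flip x"
| "step P Tu x y \<longleftrightarrow> y = turn x"
| "step P (Ge g e) x y \<longleftrightarrow> (if e then (x, y) \<in> P g else (y, x) \<in> P g)"

fun path :: "partial \<Rightarrow> letter list \<Rightarrow> pt \<Rightarrow> pt \<Rightarrow> bool" where
  "path P [] x y \<longleftrightarrow> x = y"
| "path P (l # w) x y \<longleftrightarrow> (\<exists>z. step P l x z \<and> path P w z y)"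

lemma path_append: "path P (u @ v) x y \<longleftrightarrow> (\<exists>z. path P u x z \<and> path P v z y)"
  by (induction u arbitrary: x) auto

definition maps :: "partial \<Rightarrow> letter list \<Rightarrow> pt set \<Rightarrow> pt set \<Rightarrow> bool" where
  "maps P w T T' \<longleftrightarrow> (\<forall>x\<in>T. \<exists>y\<in>T'. path P w x y)"

definition reach :: "partial \<Rightarrow> pt set \<Rightarrow> pt set \<Rightarrow> bool" where
  "reach P T T' \<longleftrightarrow> (\<exists>w. maps P w T T')"

text \<open>Total interpretations of the generators, subject only to the prescribed commutations and
  not tied to any \<open>partial\<close>. Equations between words valid in all of them play the part
  of formal consequences of the commutations.\<close>

definition model :: "(gen \<Rightarrow> pt \<Rightarrow> pt) \<Rightarrow> bool" where
  "model M \<longleftrightarrow> (\<forall>g. bij (M g) \<and> (\<forall>x. M g (act (fst g) x) = act (fst g) (M g x)))"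

fun evl :: "(gen \<Rightarrow> pt \<Rightarrow> pt) \<Rightarrow> letter \<Rightarrow> pt \<Rightarrow> pt" where
  "evl M Fl = flip" | "evl M Tu = turn" | "evl M (Ge g e) = (if e then M g else inv_into UNIV (M g))"

fun ev :: "(gen \<Rightarrow> pt \<Rightarrow> pt) \<Rightarrow> letter list \<Rightarrow> pt \<Rightarrow> pt" where
  "ev M [] = id" | "ev M (l # w) = ev M w \<circ> evl M l"

lemma ev_append: "ev M (u @ v) = ev M v \<circ> ev M u"
  by (induction u) (auto simp: fun_eq_iff)

lemma bij_flip: "bij flip" by (rule o_bij[of flip]) (auto simp: fun_eq_iff)
lemma bij_turn: "bij turn" by (rule o_bij[of "turn \<circ> turn"]) (auto simp: fun_eq_iff)

lemma bij_ev: "model M \<Longrightarrow> bij (ev M w)"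
proof (induction w)
  case (Cons l w)
  have "bij (evl M l)" using Cons.prems bij_flip bij_turn
    by (cases l) (auto simp: model_def bij_imp_bij_inv)
  then show ?case unfolding ev.simps using Cons bij_comp by blast
qed auto

lemma model_cyc:
  assumes "model M" "h \<in> cyc (fst g)"
  shows "h \<circ> M g = M g \<circ> h"
  using cyc_commute[of "fst g" "M g" h] assms by (auto simp: model_def fun_eq_iff)

lemma model_inv:
  assumes "model M"
  shows "inv_into UNIV (M g) \<circ> M g = id" "M g \<circ> inv_into UNIV (M g) = id"
  using assms by (auto simp: model_def bij_is_inj bij_is_surj surj_iff[symmetric])

fun linv :: "letter \<Rightarrow> letter list" where
  "linv Fl = [Fl]" | "linv Tu = [Tu, Tu]" | "linv (Ge g e) = [Ge g (\<not> e)]"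

fun winv :: "letter list \<Rightarrow> letter list" where
  "winv [] = []" | "winv (l # w) = winv w @ linv l"

lemma path_linv: "path P (linv l) y x \<longleftrightarrow> step P l x y"
proof -
  have "x = turn (turn y) \<longleftrightarrow> y = turn x" "x = flip y \<longleftrightarrow> y = flip x" by (metis turn3) (metis flip2)
  then show ?thesis by (cases l) auto
qed

lemma path_winv: "path P (winv w) y x \<longleftrightarrow> path P w x y"
  by (induction w arbitrary: x) (auto simp: path_append path_linv)

lemma ev_winv:
  assumes "model M"
  shows "ev M (winv w) \<circ> ev M w = id" "ev M w \<circ> ev M (winv w) = id"
proof -
  have l: "ev M (linv l) (evl M l x) = x" for l x
    using model_inv[OF assms] by (cases l) (auto simp: fun_eq_iff)
  have *: "ev M (winv w) (ev M w x) = x" for x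
    by (induction w arbitrary: x) (auto simp: ev_append l)
  then show "ev M (winv w) \<circ> ev M w = id" by auto
  show "ev M w \<circ> ev M (winv w) = id"
    using * bij_ev[OF assms, of w] by (metis (no_types, lifting) ext comp_apply id_apply bij_pointE)
qed

text \<open>Triviality of a word is measured in all total models at once, so no normal forms are needed.\<close>

definition acts_as :: "letter list \<Rightarrow> (pt \<Rightarrow> pt) \<Rightarrow> bool" where
  "acts_as w f \<longleftrightarrow> (\<forall>M. model M \<longrightarrow> ev M w = f)"

definition plain :: "letter list \<Rightarrow> bool" where
  "plain w \<longleftrightarrow> set w \<subseteq> {Fl, Tu}"

lemma plain_dih:
  assumes "plain w"
  obtains f where "f \<in> dih" "acts_as w f" "\<And>P x y. path P w x y \<longleftrightarrow> y = f x"
proof -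
  have "\<exists>f \<in> dih. acts_as w f \<and> (\<forall>P x y. path P w x y \<longleftrightarrow> y = f x)"
    using assms
  proof (induction w)
    case Nil
    then show ?case by (auto simp: dih_def acts_as_def)
  next
    case (Cons l w)
    then obtain f where f: "f \<in> dih" "acts_as w f" "\<forall>P x y. path P w x y \<longleftrightarrow> y = f x"
      by (auto simp: plain_def)
    obtain h where h: "h \<in> dih" "\<forall>M. evl M l = h" "\<forall>P x y. step P l x y \<longleftrightarrow> y = h x"
      using Cons.prems by (cases l) (auto simp: plain_def dih_def)
    show ?case
      by (rule bexI[of _ "f \<circ> h"]) (use f h dih_comp in \<open>auto simp: acts_as_def\<close>)
  qed
  then show thesis using that by blast
qed

lemma dih_word:
  assumes "f \<in> dih"
  obtains w where "plain w" "acts_as w f" "\<And>P x y. path P w x y \<longleftrightarrow> y = f x"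
proof -
  have "\<exists>w. plain w \<and> acts_as w f \<and> (\<forall>P x y. path P w x y \<longleftrightarrow> y = f x)"
    using assms unfolding dih_def
    apply (elim insertE)
    subgoal by (rule exI[of _ "[]"]) (auto simp: plain_def acts_as_def)
    subgoal by (rule exI[of _ "[Tu]"]) (auto simp: plain_def acts_as_def)
    subgoal by (rule exI[of _ "[Tu,Tu]"]) (auto simp: plain_def acts_as_def)
    subgoal by (rule exI[of _ "[Fl]"]) (auto simp: plain_def acts_as_def)
    subgoal by (rule exI[of _ "[Fl,Tu]"]) (auto simp: plain_def acts_as_def)
    subgoal by (rule exI[of _ "[Fl,Tu,Tu]"]) (auto simp: plain_def acts_as_def fun_eq_iff)
    subgoal by simp
    done
  then show thesis using that by blast
qed

section \<open>Partial permutations and the invariants of a stage\<close>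

definition seed :: partial where
  "seed g = (if fst g = Refl then {(B C0, B C0)} else {})"

text \<open>A generator commuting with \<open>flip\<close> must fix its only fixed point
  \<open>B C0\<close>. So infinitely many generators carry a pair from the outset, and finiteness is
  required only outside \<open>seed\<close>.\<close>

definition valid :: "partial \<Rightarrow> bool" where
  "valid P \<longleftrightarrow>
     (\<forall>g x y y'. (x, y) \<in> P g \<longrightarrow> (x, y') \<in> P g \<longrightarrow> y = y') \<and>
     (\<forall>g x x' y. (x, y) \<in> P g \<longrightarrow> (x', y) \<in> P g \<longrightarrow> x = x') \<and>
     (\<forall>g x y. (x, y) \<in> P g \<longrightarrow> (act (fst g) x, act (fst g) y) \<in> P g) \<and>
     (\<forall>g. seed g \<subseteq> P g) \<and>
     finite {(g, x, y). (x, y) \<in> P g - seed g}"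

lemma valid_cyc:
  assumes "valid P" "(x, y) \<in> P g" "h \<in> cyc (fst g)"
  shows "(h x, h y) \<in> P g"
proof -
  have *: "(act (fst g) x, act (fst g) y) \<in> P g" if "(x, y) \<in> P g" for x y
    using assms that by (auto simp: valid_def)
  show ?thesis using *[OF assms(2)] *[OF *[OF assms(2)]] assms(2,3)
    by (cases "fst g") auto
qed

lemma step_inject:
  assumes "valid P"
  shows "step P l x y \<Longrightarrow> step P l x y' \<Longrightarrow> y = y'" "step P l x y \<Longrightarrow> step P l x' y \<Longrightarrow> x = x'"
  using assms by (cases l; auto simp: valid_def split: if_splits; blast)+

lemma path_fun:
  assumes "valid P"
  shows "path P w x y \<Longrightarrow> path P w x y' \<Longrightarrow> y = y'"
  by (induction w arbitrary: x) (auto, metis step_inject[OF assms])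

lemma path_inject:
  assumes "valid P"
  shows "path P w x y \<Longrightarrow> path P w x' y \<Longrightarrow> x = x'"
  using path_fun[OF assms, of "winv w"] by (simp add: path_winv)

lemma path_mono: "path P w x y \<Longrightarrow> (\<And>g. P g \<subseteq> Q g) \<Longrightarrow> path Q w x y"
proof (induction w arbitrary: x)
  case (Cons l w)
  have "step Q l x z" if "step P l x z" for z
    using that Cons.prems(2) by (cases l) (auto split: if_splits)
  then show ?case using Cons by auto
qed auto

lemma maps_mono: "maps P w T T' \<Longrightarrow> (\<And>g. P g \<subseteq> Q g) \<Longrightarrow> maps Q w T T'"
  unfolding maps_def by (meson path_mono)

lemma maps_append: "maps P u T T' \<Longrightarrow> maps P v T' T'' \<Longrightarrow> maps P (u @ v) T T''"
  unfolding maps_def by (metis path_append)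

lemma card3_finite: "card T = 3 \<Longrightarrow> finite T"
  by (metis card.infinite zero_neq_numeral)

text \<open>Partial bijections are injective, so the points reached midway form a triple
  again.\<close>

lemma maps_split:
  assumes "valid P" "card T = 3" "maps P (u @ v) T T''"
  obtains T' where "card T' = 3" "maps P u T T'" "maps P v T' T''"
proof -
  have "\<forall>x\<in>T. \<exists>z. path P u x z \<and> (\<exists>y\<in>T''. path P v z y)"
    using assms(3) unfolding maps_def path_append by blast
  then obtain f where f: "\<And>x. x \<in> T \<Longrightarrow> path P u x (f x) \<and> (\<exists>y\<in>T''. path P v (f x) y)" by metis
  have "inj_on f T" using f path_inject[OF assms(1)] by (metis inj_onI)
  then have "card (f ` T) = 3" using assms by (simp add: card_image)
  then show thesis using f by (intro that[of "f ` T"]) (auto simp: maps_def)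
qed

lemma maps_onto:
  assumes "valid P" "card T = 3" "card T' = 3" "maps P w T T'" "y \<in> T'"
  shows "\<exists>x\<in>T. path P w x y"
proof -
  obtain f where f: "\<And>x. x \<in> T \<Longrightarrow> f x \<in> T' \<and> path P w x (f x)" using assms(4) unfolding maps_def by metis
  have "inj_on f T" using f path_inject[OF assms(1)] by (metis inj_onI)
  then have "card (f ` T) = card T'" using assms by (simp add: card_image)
  moreover have "f ` T \<subseteq> T'" using f by auto
  ultimately have "f ` T = T'" using assms(3) by (metis card3_finite card_subset_eq)
  then show ?thesis using f assms(5) by blast
qed

lemma maps_winv:
  assumes "valid P" "card T = 3" "card T' = 3" "maps P w T T'"
  shows "maps P (winv w) T' T"
  using maps_onto[OF assms] by (auto simp: maps_def path_winv)

lemma reach_trans: "reach P T T' \<Longrightarrow> reach P T' T'' \<Longrightarrow> reach P T T''"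
  unfolding reach_def by (meson maps_append)

lemma reach_sym: "valid P \<Longrightarrow> card T = 3 \<Longrightarrow> card T' = 3 \<Longrightarrow> reach P T T' \<Longrightarrow> reach P T' T"
  unfolding reach_def by (meson maps_winv)

lemma reach_mono: "reach P T T' \<Longrightarrow> (\<And>g. P g \<subseteq> Q g) \<Longrightarrow> reach Q T T'"
  unfolding reach_def by (meson maps_mono)

text \<open>The setwise stabilizer of \<open>T\<close> is the cyclic group of kind \<open>k\<close>,
  formally in all models as well as on points. The formal half lets a loop at \<open>T\<close> be
  moved past a generator of kind \<open>k\<close>.\<close>

definition tame :: "partial \<Rightarrow> pt set \<Rightarrow> kind \<Rightarrow> bool" where
  "tame P T k \<longleftrightarrow> card T = 3 \<and> act k ` T \<subseteq> T \<and> (\<forall>v. maps P v T T \<longrightarrow> 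
     (\<exists>h \<in> cyc k. acts_as v h \<and> (\<forall>x\<in>T. path P v x (h x))))"

text \<open>The source of uniqueness in sharp 3-transitivity. The conclusion concerns all models, so
  it applies to the limit, whatever that turns out to be.\<close>

definition free :: "partial \<Rightarrow> bool" where
  "free P \<longleftrightarrow> (\<forall>w T. card T = 3 \<longrightarrow> (\<forall>x\<in>T. path P w x x) \<longrightarrow> acts_as w id)"

definition stage :: "partial \<Rightarrow> bool" where
  "stage P \<longleftrightarrow> valid P \<and> free P \<and>
     (\<forall>T. card T = 3 \<longrightarrow> reach P T base \<or> (\<exists>T1 k. reach P T T1 \<and> tame P T1 k))"

lemma acts_as_conj:
  assumes "acts_as (winv w @ v @ w) id"
  shows "acts_as v id"
  unfolding acts_as_def
proof (intro allI impI)
  fix M assume M: "model M"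
  have "ev M (winv w @ v @ w) = id" using assms M by (simp add: acts_as_def)
  then have "ev M w (ev M v (ev M (winv w) x)) = x" for x by (auto simp: ev_append fun_eq_iff)
  then have "ev M w (ev M v x) = ev M w x" for x
    using ev_winv[OF M, of w] by (metis comp_apply id_apply)
  then have "ev M v x = x" for x using bij_ev[OF M, of w] by (metis bij_pointE)
  then show "ev M v = id" by auto
qed

text \<open>\<open>v\<close> permutes the base like some \<open>f\<close> in \<open>dih\<close>.
  Following \<open>v\<close> by a word for the inverse of \<open>f\<close> fixes three points, so
  freeness makes the product trivial.\<close>

lemma free_base_loop:
  assumes "valid P" "free P" "maps P v base base"
  shows "\<exists>f \<in> dih. acts_as v f \<and> (\<forall>x\<in>base. path P v x (f x))"
proof -
  obtain a where a: "\<And>x. x \<in> base \<Longrightarrow> a x \<in> base \<and> path P v x (a x)" using assms(3) unfolding maps_def by metis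
  have inj: "inj_on a base" using a path_inject[OF assms(1)] by (metis inj_onI)
  then have "distinct [a (B C0), a (B C1), a (B C2)]"
    by (simp add: inj_on_eq_iff[OF inj])
  then obtain f where f: "f \<in> dih" "f (B C0) = a (B C0)" "f (B C1) = a (B C1)" "f (B C2) = a (B C2)"
    using dih_base_realize a by (metis B_in_base)
  then have fa: "f x = a x" if "x \<in> base" for x using that by (auto simp: base_def)
  obtain f' where f': "f' \<in> dih" "f' \<circ> f = id" "f \<circ> f' = id" using dih_inverse f(1) by blast
  obtain w where w: "acts_as w f'" "\<And>P x y. path P w x y \<longleftrightarrow> y = f' x" using dih_word[OF f'(1)] by metis
  have "path P (v @ w) x x" if "x \<in> base" for x
    unfolding path_append w using a[OF that] fa[OF that] f'(2) by (metis comp_apply id_apply)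
  then have e: "acts_as (v @ w) id" using assms(2) card_base unfolding free_def by blast
  have "acts_as v f" unfolding acts_as_def
  proof (intro allI impI)
    fix M assume M: "model M"
    have "f' \<circ> ev M v = id" using e w M by (simp add: acts_as_def ev_append)
    then show "ev M v = f" using f' by (metis comp_assoc comp_id id_comp)
  qed
  then show ?thesis using f a fa by (metis (no_types))
qed

subsection \<open>Adding a generator\<close>

lemma maps_letter:
  assumes "valid P" "card T = 3" "maps P (u @ l # v) T T''"
  obtains T1 T2 where "card T1 = 3" "card T2 = 3" "maps P u T T1" "maps P [l] T1 T2" "maps P v T2 T''"
proof -
  obtain T1 where T1: "card T1 = 3" "maps P u T T1" "maps P ([l] @ v) T1 T''"
    using maps_split[OF assms] by auto
  obtain T2 where "card T2 = 3" "maps P [l] T1 T2" "maps P v T2 T''"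
    using maps_split[OF assms(1) T1(1,3)] by auto
  then show thesis using that T1 by blast
qed

text \<open>When only dihedral letters can be applied to \<open>T\<close>, its stabilizer lies in
  the dihedral group, and \<open>dih_stabilizer\<close> supplies the tame triple.\<close>

lemma plain_stabilizer:
  assumes P: "valid P" and T: "card T = 3" "T \<noteq> base"
    and plain: "\<And>w T'. maps P w T T' \<Longrightarrow> plain w"
  shows "\<exists>T1 k. reach P T T1 \<and> tame P T1 k"
proof -
  obtain h k where h: "h \<in> dih" "act k ` h ` T \<subseteq> h ` T"
    "\<And>u. u \<in> dih \<Longrightarrow> u ` h ` T \<subseteq> h ` T \<Longrightarrow> u \<in> cyc k"
    using dih_stabilizer[OF T] by metis
  obtain w where w: "\<And>P x y. path P w x y \<longleftrightarrow> y = h x" using dih_word[OF h(1)] by metis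
  have m: "maps P w T (h ` T)" by (auto simp: maps_def w)
  have "card (h ` T) = 3" using T dih_inj[OF h(1)] by (subst card_image) (auto simp: inj_on_def)
  moreover have "\<exists>f \<in> cyc k. acts_as v f \<and> (\<forall>x\<in>h ` T. path P v x (f x))"
    if v: "maps P v (h ` T) (h ` T)" for v
  proof -
    have "plain v" using plain[OF maps_append[OF m v]] by (auto simp: plain_def)
    then obtain f where f: "f \<in> dih" "acts_as v f" "\<And>P x y. path P v x y \<longleftrightarrow> y = f x"
      using plain_dih by metis
    have "f x \<in> h ` T" if x: "x \<in> h ` T" for x
    proof -
      obtain y where "y \<in> h ` T" "path P v x y" using v x unfolding maps_def by blast
      then show ?thesis by (simp add: f(3))
    qed
    then have "f ` h ` T \<subseteq> h ` T" by blast
    then show ?thesis using f h(3) by blast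
  qed
  ultimately have "tame P (h ` T) k" using h(2) by (simp add: tame_def)
  then show ?thesis using m by (auto simp: reach_def)
qed

lemma not_plain_split:
  assumes "\<not> plain w"
  obtains u g e v where "w = u @ Ge g e # v" "plain u"
proof -
  have "\<exists>l\<in>set w. \<not> plain [l]" using assms by (auto simp: plain_def)
  then obtain u l v where w: "w = u @ l # v" "\<not> plain [l]" "\<forall>l\<in>set u. plain [l]"
    using split_list_first_prop[of w "\<lambda>l. \<not> plain [l]"] by blast
  obtain g e where "l = Ge g e" using w(2) by (cases l) (auto simp: plain_def)
  moreover have "plain u" using w(3) by (auto simp: plain_def)
  ultimately show thesis using that w(1) by blast
qed

section \<open>The initial stage\<close>

lemma valid_seed: "valid seed"
proof -
  have "{(g, x, y). (x, y) \<in> seed g - seed g} = {}" by auto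
  then have "finite {(g, x, y). (x, y) \<in> seed g - seed g}" by (simp only: finite.emptyI)
  then show ?thesis unfolding valid_def by (intro conjI; (assumption | simp add: seed_def))
qed

text \<open>In \<open>seed\<close> a generator is defined at \<open>B C0\<close> at most, so no
  triple survives a generator letter.\<close>

lemma seed_plain:
  assumes T: "card T = 3" and m: "maps seed w T T'"
  shows "plain w"
proof (rule ccontr)
  assume "\<not> plain w"
  then obtain u g e v where "w = u @ Ge g e # v" using not_plain_split by metis
  then obtain T1 T2 where "card T1 = 3" "maps seed [Ge g e] T1 T2"
    using maps_letter[OF valid_seed T] m by metis
  then have "card T1 = 3" "T1 \<subseteq> {B C0}"
    by (auto simp: maps_def seed_def split: if_splits)
  then show False using card_mono[of "{B C0}" T1] by simp
qed

lemma stage_seed: "stage seed"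
proof -
  have "free seed" unfolding free_def
  proof (intro allI impI)
    fix w T assume T: "card T = 3" "\<forall>x\<in>T. path seed w x x"
    then have "maps seed w T T" by (auto simp: maps_def)
    then obtain f where f: "f \<in> dih" "acts_as w f" "\<And>P x y. path P w x y \<longleftrightarrow> y = f x"
      using plain_dih seed_plain T by metis
    have fx: "f x = x" if "x \<in> T" for x using T f(3) that by metis
    have "f = id"
    proof (cases "T \<subseteq> base")
      case True
      then have "T = base" using T by (metis card_base card_subset_eq)
      then show ?thesis using fx f(1) dih_base_faithful by auto
    next
      case False
      then obtain x where x: "x \<in> T" "x \<notin> base" by auto
      then obtain n b c where "x = F n b c" by (cases x) auto
      then show ?thesis using dih_free[OF f(1), of id] fx x by (auto simp: dih_def)
    qed
    then show "acts_as w id" using f by simp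
  qed
  moreover have "reach seed T base \<or> (\<exists>T1 k. reach seed T T1 \<and> tame seed T1 k)" if "card T = 3" for T
  proof (cases "T = base")
    case True
    then have "maps seed [] T base" by (simp add: maps_def)
    then show ?thesis by (auto simp: reach_def)
  next
    case False
    then show ?thesis using plain_stabilizer[OF valid_seed that] seed_plain[OF that] by blast
  qed
  ultimately show ?thesis using valid_seed by (simp add: stage_def)
qed

text \<open>The new generator is \<open>f\<close>, joining the base to a triple of another orbit.
  The base has stabilizer \<open>dih\<close>, \<open>T1\<close> has \<open>cyc k\<close>, and the
  generator centralizes \<open>cyc k\<close>. As in an HNN extension, the generator and its inverse
  cancel around elements of \<open>cyc k\<close>.\<close>

locale glue_base =
  fixes P :: partial and T1 :: "pt set" and k :: kind and n :: nat and f :: "pt \<Rightarrow> pt"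
  assumes stage: "stage P" and tame: "tame P T1 k" and apart: "\<not> reach P T1 base"
    and unused: "P (k, n) \<subseteq> seed (k, n)" and bij: "bij_betw f base T1"
    and equivariant: "\<And>x. x \<in> base \<Longrightarrow> f (act k x) = act k (f x)"
begin

abbreviation g :: gen where "g \<equiv> (k, n)"

definition Q :: partial where "Q = P(g := (\<lambda>x. (x, f x)) ` base)"

lemma edge_g: "x \<in> base \<Longrightarrow> (x, f x) \<in> Q g"
  by (simp add: Q_def)

lemma valid_P: "valid P" and free_P: "free P" using stage by (auto simp: stage_def)

lemma T1: "card T1 = 3" "finite T1" using tame card3_finite by (auto simp: tame_def)

lemma act_base: "x \<in> base \<Longrightarrow> act k x \<in> base"
  using dih_base cyc_dih cyc_act by blast

lemma f_cyc: "h \<in> cyc k \<Longrightarrow> x \<in> base \<Longrightarrow> f (h x) = h (f x)"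
  using equivariant act_base[of x] by (cases k) (auto simp: act_base)

lemma f_T1: "x \<in> base \<Longrightarrow> f x \<in> T1" using bij by (auto simp: bij_betw_def)

lemma valid_Q: "valid Q"
proof -
  have inj: "f x = f y \<longleftrightarrow> x = y" if "x \<in> base" "y \<in> base" for x y
    using bij that by (auto simp: bij_betw_def inj_on_def)
  \<comment> \<open>\<open>Q\<close> overwrites the pairs of \<open>g\<close>, so the seed pair must
    be found again: equivariance makes \<open>f\<close> send \<open>B C0\<close> to a fixed point of
    \<open>flip\<close>, that is, to itself.\<close>
  have seed: "seed g \<subseteq> Q g"
  proof (cases "k = Refl")
    case True
    then have "flip (f (B C0)) = f (B C0)" using equivariant[of "B C0"] by simp
    then have "f (B C0) = B C0" by simp
    then show ?thesis using True edge_g[of "B C0"] by (simp add: seed_def)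
  qed (auto simp: seed_def)
  have "{(g', x, y). (x, y) \<in> Q g' - seed g'} \<subseteq>
     {(g', x, y). (x, y) \<in> P g' - seed g'} \<union> (\<lambda>x. (g, x, f x)) ` base"
    by (auto simp: Q_def split: if_splits)
  then have "finite {(g', x, y). (x, y) \<in> Q g' - seed g'}"
    by (rule finite_subset) (use valid_P in \<open>auto simp: valid_def\<close>)
  then show ?thesis using valid_P inj seed act_base equivariant unfolding valid_def
    by (auto simp: Q_def image_iff)
qed

lemma P_le_Q: "P g' \<subseteq> Q g'"
proof (cases "g' = g")
  case True
  have "seed g \<subseteq> Q g" using valid_Q unfolding valid_def by blast
  then show ?thesis using unused True by blast
qed (auto simp: Q_def)

lemma path_Q: "(\<And>e. Ge g e \<notin> set w) \<Longrightarrow> path Q w x y \<longleftrightarrow> path P w x y"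
proof (induction w arbitrary: x)
  case (Cons l w)
  have "step Q l x z \<longleftrightarrow> step P l x z" for z using Cons.prems
    by (cases l) (auto simp: Q_def)
  then show ?case using Cons by auto
qed auto

lemma maps_Q: "(\<And>e. Ge g e \<notin> set w) \<Longrightarrow> maps Q w T T' \<longleftrightarrow> maps P w T T'"
  by (simp add: maps_def path_Q)

text \<open>The letter is defined on three points only, so a triple passing through it is the whole
  domain and leaves as the whole range.\<close>

lemma maps_letter_Q:
  assumes "card T = 3" "card T' = 3" "maps Q [Ge g e] T T'"
  shows "T = (if e then base else T1) \<and> T' = (if e then T1 else base)"
proof -
  have "T \<subseteq> (if e then base else T1)"
    using assms(3) f_T1 by (auto simp: maps_def Q_def split: if_splits)
  moreover have "T' \<subseteq> (if e then T1 else base)"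
    using maps_onto[OF valid_Q assms] f_T1 by (fastforce simp: Q_def split: if_splits)
  ultimately show ?thesis using assms T1 card_base by (metis card_subset_eq)
qed

lemma first_use:
  assumes "Ge g e0 \<in> set w" "card T = 3" "maps Q w T T''"
  obtains u e v where "w = u @ Ge g e # v" "maps P u T (if e then base else T1)"
    "maps Q [Ge g e] (if e then base else T1) (if e then T1 else base)"
    "maps Q v (if e then T1 else base) T''"
proof -
  have "\<exists>l\<in>set w. l \<in> range (Ge g)" using assms(1) by auto
  then obtain u l v where w: "w = u @ l # v" "l \<in> range (Ge g)" "\<forall>l\<in>set u. l \<notin> range (Ge g)"
    using split_list_first_prop[of w "\<lambda>l. l \<in> range (Ge g)"] by blast
  then obtain e where l: "l = Ge g e" by auto
  obtain T' T2 where T: "card T' = 3" "card T2 = 3" "maps Q u T T'" "maps Q [l] T' T2" "maps Q v T2 T''"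
    using maps_letter[OF valid_Q assms(2)] assms(3) w(1) by metis
  have "maps P u T T'" using T(3) w(3) by (subst maps_Q[symmetric]) auto
  then show thesis using that[of u e v] w(1) T l maps_letter_Q[of T' T2 e] by simp
qed

lemma not_reach: "\<not> maps P w T1 base" "\<not> maps P w base T1"
  using apart reach_sym[OF valid_P _ _ , of base T1] T1 by (auto simp: reach_def)

text \<open>Without the new generator no word links the base with \<open>T1\<close>. So a loop at
  the base that uses it goes to \<open>T1\<close>, runs through a loop there inside \<open>P\<close>
  and returns. Tameness makes that inner loop an element of \<open>cyc k\<close>, which commutes
  with the generator; induction treats the rest.\<close>

lemma base_loop:
  "maps Q v base base \<Longrightarrow> \<exists>h \<in> dih. acts_as v h \<and> (\<forall>x\<in>base. path Q v x (h x))"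
proof (induction v rule: length_induct)
  case (1 v)
  show ?case
  proof (cases "\<exists>e. Ge g e \<in> set v")
    case False
    then show ?thesis
      using free_base_loop[OF valid_P free_P, of v] maps_Q[of v] path_Q[of v] 1 by auto
  next
    case True
    then obtain u e v' where ue: "v = u @ Ge g e # v'" "maps P u base (if e then base else T1)"
      "maps Q v' (if e then T1 else base) base"
      using first_use[OF _ card_base(1) 1(2)] by blast
    moreover have e using ue(2) not_reach by (cases e) auto
    ultimately have v: "v = u @ Ge g True # v'" "maps P u base base" "maps Q v' T1 base" by auto
    then have "\<exists>e. Ge g e \<in> set v'" using maps_Q[of v' T1 base] not_reach by blast
    then obtain u2 e2 v3 where ue2: "v' = u2 @ Ge g e2 # v3" "maps P u2 T1 (if e2 then base else T1)"
      "maps Q v3 (if e2 then T1 else base) base"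
      using first_use[OF _ T1(1) v(3)] by blast
    moreover have "\<not> e2" using ue2(2) not_reach by (cases e2) auto
    ultimately have v': "v' = u2 @ Ge g False # v3" "maps P u2 T1 T1" "maps Q v3 base base" by auto
    obtain h1 where h1: "h1 \<in> dih" "acts_as u h1" "\<forall>x\<in>base. path P u x (h1 x)"
      using free_base_loop[OF valid_P free_P v(2)] by blast
    obtain h2 where h2: "h2 \<in> cyc k" "acts_as u2 h2" "\<forall>x\<in>T1. path P u2 x (h2 x)"
      using tame v'(2) by (auto simp: tame_def)
    have "length v3 < length v" using v v' by simp
    then obtain h3 where h3: "h3 \<in> dih" "acts_as v3 h3" "\<forall>x\<in>base. path Q v3 x (h3 x)"
      using 1(1) v'(3) by blast
    have "acts_as v (h3 \<circ> h2 \<circ> h1)" unfolding acts_as_def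
    proof (intro allI impI)
      fix M assume M: "model M"
      have "ev M v = h3 \<circ> (inv_into UNIV (M g) \<circ> (h2 \<circ> M g)) \<circ> h1"
        using M h1(2) h2(2) h3(2) by (simp add: v v' ev_append acts_as_def o_assoc)
      then show "ev M v = h3 \<circ> h2 \<circ> h1"
        using model_cyc[OF M, of h2 g] h2(1) model_inv[OF M, of g] by (simp add: fun_eq_iff)
    qed
    moreover have "path Q v x ((h3 \<circ> h2 \<circ> h1) x)" if x: "x \<in> base" for x
    proof -
      have b: "h1 x \<in> base" "h2 (h1 x) \<in> base" using x h1 h2 dih_base cyc_dih by blast+
      have "path Q u x (h1 x)" using h1 x P_le_Q path_mono by blast
      moreover have "step Q (Ge g True) (h1 x) (f (h1 x))" using b by (simp add: Q_def)
      moreover have "path Q u2 (f (h1 x)) (h2 (f (h1 x)))" using h2 b f_T1 P_le_Q path_mono by blast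
      moreover have "step Q (Ge g False) (h2 (f (h1 x))) (h2 (h1 x))"
        using edge_g[OF b(2)] f_cyc[OF h2(1) b(1)] by simp
      moreover have "path Q v3 (h2 (h1 x)) (h3 (h2 (h1 x)))" using h3 b by blast
      ultimately show ?thesis unfolding v v' path_append path.simps comp_apply by blast
    qed
    moreover have "h3 \<circ> h2 \<circ> h1 \<in> dih" using h1 h2 h3 cyc_dih dih_comp by blast
    ultimately show ?thesis by blast
  qed
qed

text \<open>A word that uses the new generator carries its triple through the base, on one side of
  the letter or the other. Starting the cyclic word there turns it into a loop at the base, to which
  \<open>base_loop\<close> applies.\<close>

lemma free_Q: "free Q"
  unfolding free_def
proof (intro allI impI)
  fix w T assume T: "card T = 3" and fix_w: "\<forall>x\<in>T. path Q w x x"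
  then have m: "maps Q w T T" by (auto simp: maps_def)
  show "acts_as w id"
  proof (cases "\<exists>e. Ge g e \<in> set w")
    case False
    then show ?thesis using free_P T fix_w path_Q[of w] unfolding free_def by blast
  next
    case True
    then obtain u e v where w: "w = u @ Ge g e # v" "maps P u T (if e then base else T1)"
      "maps Q [Ge g e] (if e then base else T1) (if e then T1 else base)"
      using first_use[OF _ T m] by blast
    have "\<exists>p q. w = p @ q \<and> maps Q p T base"
    proof (cases e)
      case True
      then show ?thesis using w maps_mono[of P u T base Q] P_le_Q by auto
    next
      case False
      then have "maps Q (u @ [Ge g e]) T base"
        using w maps_mono[of P u T T1 Q] P_le_Q maps_append by auto
      then show ?thesis using w by (intro exI[of _ "u @ [Ge g e]"] exI[of _ v]) simp
    qed
    then obtain p q where w: "w = p @ q" "maps Q p T base" by blast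
    have fx: "path Q (q @ p) y y" if y: "y \<in> base" for y
    proof -
      obtain x where x: "x \<in> T" "path Q p x y" using maps_onto[OF valid_Q T card_base(1) w(2) y] by auto
      then have "path Q q y x" using fix_w w(1) path_fun[OF valid_Q] by (metis path_append)
      then show ?thesis using x path_append by blast
    qed
    then have "maps Q (q @ p) base base" by (auto simp: maps_def)
    then obtain h where h: "h \<in> dih" "acts_as (q @ p) h" "\<forall>x\<in>base. path Q (q @ p) x (h x)"
      using base_loop by blast
    then have "h = id" using fx path_fun[OF valid_Q] dih_base_faithful by metis
    then have qp: "acts_as (q @ p) id" using h by simp
    have "acts_as (winv p @ w @ p) id" unfolding acts_as_def
    proof (intro allI impI)
      fix M assume M: "model M"
      have "ev M p (ev M (winv p) x) = x" for x using ev_winv[OF M, of p] by (auto simp: fun_eq_iff)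
      moreover have "ev M p (ev M q x) = x" for x using qp M by (auto simp: acts_as_def ev_append fun_eq_iff)
      ultimately show "ev M (winv p @ w @ p) = id" by (auto simp: w ev_append)
    qed
    then show ?thesis by (rule acts_as_conj)
  qed
qed

lemma reach_T1: "reach Q T1 base"
proof -
  have "maps Q [Ge g False] T1 base" using bij by (auto simp: maps_def Q_def bij_betw_def)
  then show ?thesis by (auto simp: reach_def)
qed

lemma stage_Q: "stage Q"
proof -
  have "reach Q T base \<or> (\<exists>T1 k. reach Q T T1 \<and> tame Q T1 k)" if T: "card T = 3" for T
  \<comment> \<open>Triples that can be brought to the new generator reach the base through it; on
    the others no new words are defined, and tameness persists.\<close>
  proof (cases "\<exists>w e T'. Ge g e \<in> set w \<and> maps Q w T T'")
    case True
    then obtain u e where "maps P u T (if e then base else T1)"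
      using first_use[OF _ T] by blast
    then have "reach P T (if e then base else T1)" unfolding reach_def by blast
    then have "reach Q T (if e then base else T1)" using reach_mono P_le_Q by blast
    then show ?thesis using reach_trans[OF _ reach_T1] by (cases e) auto
  next
    case False
    consider "reach P T base" | T2 k' where "reach P T T2" "tame P T2 k'"
      using stage T by (auto simp: stage_def)
    then show ?thesis
    proof cases
      case 1
      then show ?thesis using reach_mono P_le_Q by blast
    next
      case 2
      have r: "reach Q T T2" using 2(1) reach_mono P_le_Q by blast
      have "tame Q T2 k'" unfolding tame_def
      proof (intro conjI allI impI)
        show "card T2 = 3" "act k' ` T2 \<subseteq> T2" using 2 by (auto simp: tame_def)
        fix v assume v: "maps Q v T2 T2"
        obtain w where "maps Q w T T2" using r by (auto simp: reach_def)
        then have "maps Q (w @ v) T T2" using v maps_append by blast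
        then have "Ge g e \<notin> set (w @ v)" for e using False by blast
        then have "Ge g e \<notin> set v" for e by simp
        then have "maps P v T2 T2" using v maps_Q by blast
        then show "\<exists>h\<in>cyc k'. acts_as v h \<and> (\<forall>x\<in>T2. path Q v x (h x))"
          using 2 P_le_Q path_mono unfolding tame_def by meson
      qed
      then show ?thesis using r by blast
    qed
  qed
  then show ?thesis using valid_Q free_Q by (simp add: stage_def)
qed

end

subsection \<open>Extending a generator\<close>

definition orb :: "nat \<Rightarrow> pt set" where "orb n = {F n b c | b c. True}"

lemma orb_dih: "f \<in> dih \<Longrightarrow> f x \<in> orb n \<longleftrightarrow> x \<in> orb n"
  by (cases x) (auto simp: dih_def orb_def)

text \<open>The missing value of \<open>g\<close> at \<open>a\<close> (of its inverse, if
  \<open>e\<close> is false) is chosen in the regular orbit \<open>n\<close>, which no pair meets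
  yet.\<close>

locale extend_generator =
  fixes P :: partial and g :: gen and e :: bool and a :: pt and n :: nat
  assumes stage: "stage P" and undefined: "\<And>y. \<not> step P (Ge g e) a y"
    and unused: "\<And>g' x y. (x, y) \<in> P g' \<Longrightarrow> x \<notin> orb n \<and> y \<notin> orb n" and a: "a \<notin> orb n"
begin

definition p :: pt where "p = F n False C0"

text \<open>Equivariance forces the whole orbit of the new pair under the cyclic group. The pairs of
  \<open>E\<close> run from old to new points, whatever the direction \<open>e\<close>.\<close>

definition E :: "(pt \<times> pt) set" where "E = (\<lambda>h. (h a, h p)) ` cyc (fst g)"

definition Q :: partial where "Q = P(g := P g \<union> (if e then E else E\<inverse>))"

lemma valid_P: "valid P" and free_P: "free P" using stage by (auto simp: stage_def)

lemma step_Q: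
  "step Q (Ge g' e') x y \<longleftrightarrow> step P (Ge g' e') x y \<or> (g' = g \<and> e' = e \<and> (x, y) \<in> E) \<or>
     (g' = g \<and> e' = (\<not> e) \<and> (y, x) \<in> E)"
  unfolding Q_def by (cases e'; simp; metis Un_iff converse_iff fun_upd_apply)

lemma E_orb: "(x, y) \<in> E \<Longrightarrow> x \<notin> orb n \<and> y \<in> orb n"
proof -
  assume "(x, y) \<in> E"
  then obtain h where h: "h \<in> cyc (fst g)" "x = h a" "y = h p" by (auto simp: E_def)
  have "p \<in> orb n" by (auto simp: p_def orb_def)
  then show ?thesis using a h orb_dih[OF cyc_dih[OF h(1)]] by simp
qed

lemma step_P_orb: "step P (Ge g' e') x y \<Longrightarrow> x \<notin> orb n \<and> y \<notin> orb n"
  using unused by (auto split: if_splits)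

lemma step_P_cyc: "valid R \<Longrightarrow> step R (Ge g' e') x y \<Longrightarrow> h \<in> cyc (fst g') \<Longrightarrow> step R (Ge g' e') (h x) (h y)"
  using valid_cyc by (auto split: if_splits)

lemma E_new:
  assumes "(x, y) \<in> E"
  shows "\<not> step P (Ge g e) x z"
proof
  assume s: "step P (Ge g e) x z"
  obtain h where h: "h \<in> cyc (fst g)" "x = h a" using assms by (auto simp: E_def)
  obtain h' where h': "h' \<in> cyc (fst g)" "h' \<circ> h = id" using cyc_inverse[OF h(1)] by blast
  have "h' x = a" using h h' by (metis comp_apply id_apply)
  then have "step P (Ge g e) a (h' z)" using step_P_cyc[OF valid_P s h'(1)] by simp
  then show False using undefined by blast
qed

text \<open>The seed already defines generators of kind \<open>Refl\<close> at \<open>B C0\<close>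
  in both directions. Hence the cyclic group moves \<open>a\<close> freely, and \<open>E\<close> is
  a partial bijection.\<close>

lemma a_not_fixed: "fst g = Refl \<Longrightarrow> a \<noteq> B C0"
proof
  assume "fst g = Refl" "a = B C0"
  moreover have "seed g \<subseteq> P g" using valid_P unfolding valid_def by blast
  ultimately have "(a, a) \<in> P g" by (simp add: seed_def)
  then show False using undefined[of a] by simp
qed

lemma E_unique: "(x, y) \<in> E \<Longrightarrow> (x, y') \<in> E \<Longrightarrow> y = y'" "(x, y) \<in> E \<Longrightarrow> (x', y) \<in> E \<Longrightarrow> x = x'"
  using cyc_free[of _ "fst g" _ a] cyc_free[of _ "fst g" _ p] a_not_fixed
  by (auto simp: E_def p_def)

lemma step_Q_fun:
  assumes "step Q (Ge g' e') x y" "step Q (Ge g' e') x y'"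
  shows "y = y'"
  using assms step_inject(1)[OF valid_P, of "Ge g' e'" x y y'] E_unique E_orb step_P_orb E_new
  unfolding step_Q by blast

lemma P_le_Q: "P g' \<subseteq> Q g'"
  by (auto simp: Q_def)

lemma valid_Q: "valid Q"
proof -
  have "finite E" by (cases "fst g") (auto simp: E_def)
  then have "finite (\<Union>(x, y)\<in>E. {(g, x, y), (g, y, x)})" by auto
  moreover have "{(g', x, y). (x, y) \<in> Q g' - seed g'} \<subseteq>
     {(g', x, y). (x, y) \<in> P g' - seed g'} \<union> (\<Union>(x, y)\<in>E. {(g, x, y), (g, y, x)})"
    by (auto simp: Q_def split: if_splits)
  moreover have "finite {(g', x, y). (x, y) \<in> P g' - seed g'}" using valid_P unfolding valid_def by blast
  ultimately have fin: "finite {(g', x, y). (x, y) \<in> Q g' - seed g'}"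
    by (meson finite_UnI finite_subset)
  have act: "(act (fst g') x, act (fst g') y) \<in> Q g'" if "(x, y) \<in> Q g'" for g' x y
  proof -
    have "(act (fst g) x, act (fst g) y) \<in> E" if xy: "(x, y) \<in> E" for x y
    proof -
      obtain h where h: "h \<in> cyc (fst g)" "x = h a" "y = h p" using xy by (auto simp: E_def)
      then have "act (fst g) \<circ> h \<in> cyc (fst g)" using cyc_comp cyc_act by blast
      then show ?thesis unfolding E_def using h by (intro image_eqI[of _ _ "act (fst g) \<circ> h"]) auto
    qed
    then show ?thesis using that valid_cyc[OF valid_P _ cyc_act, of x y g']
      by (auto simp: Q_def split: if_splits)
  qed
  have "seed g' \<subseteq> Q g'" for g' using valid_P P_le_Q[of g'] unfolding valid_def by blast
  moreover have "y = y'" if "(x, y) \<in> Q g'" "(x, y') \<in> Q g'" for g' x y y'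
    using step_Q_fun[of g' True x y y'] that by simp
  moreover have "x = x'" if "(x, y) \<in> Q g'" "(x', y) \<in> Q g'" for g' x x' y
    using step_Q_fun[of g' False y x x'] that by simp
  ultimately show ?thesis using fin act unfolding valid_def by blast
qed

lemma plain_step: "plain [l] \<Longrightarrow> step R l x z \<Longrightarrow> z \<in> orb n \<longleftrightarrow> x \<in> orb n"
  by (cases l; cases x) (auto simp: plain_def orb_def)

text \<open>Dihedral letters stay in the new orbit and old pairs do not meet it, so the only way out
  is a new pair read backwards.\<close>

lemma path_exit:
  "path Q w x y \<Longrightarrow> x \<in> orb n \<Longrightarrow> y \<notin> orb n \<Longrightarrow> \<exists>u v. w = u @ Ge g (\<not> e) # v \<and> plain u"
proof (induction w arbitrary: x)
  case (Cons l w)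
  then obtain z where z: "step Q l x z" "path Q w z y" by auto
  show ?case
  proof (cases "plain [l]")
    case True
    then have "z \<in> orb n" using plain_step[OF True z(1)] Cons.prems by simp
    then obtain u v where "w = u @ Ge g (\<not> e) # v" "plain u" using Cons.IH[OF z(2)] Cons.prems by blast
    then have "l # w = (l # u) @ Ge g (\<not> e) # v" "plain (l # u)" using True by (auto simp: plain_def)
    then show ?thesis by blast
  next
    case False
    then obtain g' e' where l: "l = Ge g' e'" by (cases l) (auto simp: plain_def)
    then have "l = Ge g (\<not> e)" using z(1) step_Q E_orb step_P_orb Cons.prems(2) by blast
    then have "l # w = [] @ Ge g (\<not> e) # w" "plain []" by (auto simp: plain_def)
    then show ?thesis by blast
  qed
qed auto

lemma path_entry:
  "path Q w x y \<Longrightarrow> x \<notin> orb n \<Longrightarrow> y \<notin> orb n \<Longrightarrow> path P w x y \<or>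
     (\<exists>u v b b'. w = u @ Ge g e # v \<and> (b, b') \<in> E \<and> path Q v b' y)"
proof (induction w arbitrary: x)
  case (Cons l w)
  then obtain z where z: "step Q l x z" "path Q w z y" by auto
  show ?case
  proof (cases "z \<in> orb n")
    case True
    then have "\<not> plain [l]" using plain_step[OF _ z(1)] Cons.prems by auto
    then obtain g' e' where l: "l = Ge g' e'" by (cases l) (auto simp: plain_def)
    have "step Q (Ge g' e') x z" using z(1) l by simp
    then have "g' = g \<and> e' = e \<and> (x, z) \<in> E" unfolding step_Q using E_orb step_P_orb True by blast
    then have "l # w = [] @ Ge g e # w \<and> (x, z) \<in> E \<and> path Q w z y" using z l by simp
    then show ?thesis by blast
  next
    case False
    have "step P l x z"
    proof (cases l)
      case (Ge g' e')
      have "step Q (Ge g' e') x z" using z(1) Ge by simp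
      then show ?thesis unfolding step_Q Ge using E_orb Cons.prems(2) False by blast
    qed (use z(1) in auto)
    moreover have "path P w z y \<or> (\<exists>u v b b'. w = u @ Ge g e # v \<and> (b, b') \<in> E \<and> path Q v b' y)"
      using Cons.IH[OF z(2) False] Cons.prems by blast
    ultimately show ?thesis by (metis append_Cons path.simps(2))
  qed
qed auto

text \<open>
  A path through the new orbit leaves it by the edge family it came in by; between the two it runs
  along a word acting as an element of the cyclic group commuting with the generator, so the two
  occurrences of the generator cancel.
\<close>

lemma shorten:
  assumes "path Q w x y" "x \<notin> orb n" "y \<notin> orb n" "\<not> path P w x y"
  obtains w' where "length w' < length w" "\<And>M. model M \<Longrightarrow> ev M w' = ev M w"
    "\<And>x y. path Q w x y \<Longrightarrow> path Q w' x y"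
proof -
  obtain w1 w2 b b' where w: "w = w1 @ Ge g e # w2" "(b, b') \<in> E" "path Q w2 b' y"
    using path_entry[OF assms(1-3)] assms(4) by blast
  then obtain u w3 where w2: "w2 = u @ Ge g (\<not> e) # w3" "plain u"
    using path_exit[of w2 b' y] E_orb assms(3) by blast
  then obtain f where f: "f \<in> dih" "acts_as u f" "\<And>P x y. path P u x y \<longleftrightarrow> y = f x"
    using plain_dih by metis
  obtain c where "step Q (Ge g (\<not> e)) (f b') c" using w(3) unfolding w2 path_append f by auto
  moreover have "f b' \<in> orb n" using E_orb[OF w(2)] orb_dih[OF f(1)] by simp
  ultimately have c: "(c, f b') \<in> E" unfolding step_Q using step_P_orb E_orb by blast
  obtain h where h: "h \<in> cyc (fst g)" "b' = h p" using w(2) by (auto simp: E_def)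
  obtain h' where h': "h' \<in> cyc (fst g)" "f b' = h' p" using c by (auto simp: E_def)
  obtain i where i: "i \<in> cyc (fst g)" "h \<circ> i = id" using cyc_inverse[OF h(1)] by blast
  \<comment> \<open>Both sides send \<open>p\<close> to the same point of a regular orbit. This
    places \<open>f\<close> in the cyclic group.\<close>
  have "f \<circ> h = h'"
  proof (rule dih_free)
    show "f \<circ> h \<in> dih" using f h cyc_dih dih_comp by blast
    show "h' \<in> dih" using h' cyc_dih by blast
    show "(f \<circ> h) (F n False C0) = h' (F n False C0)" using h h' by (simp add: p_def)
  qed
  then have "f = h' \<circ> i" using i(2) by (metis comp_assoc comp_id)
  then have fc: "f \<in> cyc (fst g)" using cyc_comp h' i by blast
  show thesis
  proof (rule that[of "w1 @ u @ w3"])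
    show "length (w1 @ u @ w3) < length w" by (simp add: w w2)
    fix M assume M: "model M"
    have "ev M [Ge g (\<not> e)] \<circ> f \<circ> ev M [Ge g e] = f"
    proof (cases e)
      case True
      then show ?thesis using model_cyc[OF M fc] model_inv[OF M, of g] by (simp add: fun_eq_iff)
    next
      case False
      have "M g (f (inv_into UNIV (M g) x)) = f (M g (inv_into UNIV (M g) x))" for x
        using model_cyc[OF M fc] by (simp add: fun_eq_iff)
      then show ?thesis using False model_inv[OF M, of g] by (simp add: fun_eq_iff)
    qed
    then have "ev M ([Ge g e] @ u @ [Ge g (\<not> e)]) = f"
      using f(2) M by (simp add: ev_append acts_as_def fun_eq_iff)
    then have "ev M ([Ge g e] @ u @ [Ge g (\<not> e)]) = ev M u" using f(2) M by (simp add: acts_as_def)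
    moreover have "w = w1 @ ([Ge g e] @ u @ [Ge g (\<not> e)]) @ w3" by (simp add: w w2)
    ultimately show "ev M (w1 @ u @ w3) = ev M w" by (metis ev_append)
  next
    fix x y assume "path Q w x y"
    then obtain z1 z2 z3 z4 where z: "path Q w1 x z1" "step Q (Ge g e) z1 z2" "path Q u z2 z3"
      "step Q (Ge g (\<not> e)) z3 z4" "path Q w3 z4 y" unfolding w w2 path_append path.simps by blast
    \<comment> \<open>The pairs of \<open>g\<close> are stable under \<open>f\<close>, so by
      injectivity every path along \<open>w\<close> comes back at \<open>f z1\<close>, not only the
      one that revealed the cancellation.\<close>
    have "step Q (Ge g e) (f z1) (f z2)" using step_P_cyc[OF valid_Q z(2) fc] .
    moreover have "step Q (Ge g e) z4 (f z2)" using z(3,4) f(3) by auto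
    ultimately have "z4 = f z1" using step_inject(2)[OF valid_Q] by blast
    then show "path Q (w1 @ u @ w3) x y" using z f(3) unfolding path_append by blast
  qed
qed

text \<open>Repeated shortening. One word must serve all paths at once, as freeness and tameness
  look at three points at a time; each shortening keeps all paths along the word.\<close>

lemma reduce:
  "\<exists>w'. (\<forall>M. model M \<longrightarrow> ev M w' = ev M w) \<and>
     (\<forall>x y. x \<notin> orb n \<longrightarrow> y \<notin> orb n \<longrightarrow> path Q w x y \<longrightarrow> path P w' x y)"
proof (induction w rule: length_induct)
  case (1 w)
  show ?case
  proof (cases "\<forall>x y. x \<notin> orb n \<longrightarrow> y \<notin> orb n \<longrightarrow> path Q w x y \<longrightarrow> path P w x y")
    case True
    then show ?thesis by blast
  next
    case False
    then obtain w1 where w1: "length w1 < length w" "\<And>M. model M \<Longrightarrow> ev M w1 = ev M w"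
      "\<And>x y. path Q w x y \<Longrightarrow> path Q w1 x y" using shorten by metis
    then show ?thesis using 1 by metis
  qed
qed

text \<open>A generator letter applied to a point of the new orbit must read the new pairs
  backwards, and then it takes the entire triple to old points, contrary to
  \<open>old\<close>.\<close>

lemma trapped:
  assumes T: "card T = 3" and old: "\<And>v T'. maps Q v T T' \<Longrightarrow> T' \<inter> orb n \<noteq> {}"
    and w: "maps Q w T T''"
  shows "plain w"
proof (rule ccontr)
  assume "\<not> plain w"
  then obtain u g' e' v where uv: "w = u @ Ge g' e' # v" "plain u" using not_plain_split by metis
  then obtain T1 T2 where T12: "card T1 = 3" "card T2 = 3" "maps Q u T T1" "maps Q [Ge g' e'] T1 T2"
    using maps_letter[OF valid_Q T] w by metis
  obtain y where y: "y \<in> T1" "y \<in> orb n" using old[OF T12(3)] by blast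
  then obtain z where "step Q (Ge g' e') y z" using T12(4) by (auto simp: maps_def simp del: step.simps)
  then have l: "g' = g" "e' = (\<not> e)" using y step_Q step_P_orb E_orb by blast+
  have "z \<notin> orb n" if z: "z \<in> T2" for z
  proof -
    obtain y where "step Q (Ge g (\<not> e)) y z"
      using maps_onto[OF valid_Q T12(1,2,4) z] l by (auto simp del: step.simps)
    then have "step P (Ge g (\<not> e)) y z \<or> (z, y) \<in> E"
      using step_Q[of g "\<not> e" y z] by (simp del: step.simps)
    then show ?thesis using step_P_orb E_orb by blast
  qed
  moreover have "T2 \<inter> orb n \<noteq> {}" using old[OF maps_append[OF T12(3,4)]] .
  ultimately show False by blast
qed

text \<open>If the triple can be moved off the new orbit, conjugation and \<open>reduce\<close>
  bring the word back to \<open>P\<close>. Otherwise the word is plain and fixes a point of a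
  regular orbit.\<close>

lemma free_Q: "free Q"
  unfolding free_def
proof (intro allI impI)
  fix w T assume T: "card T = 3" and fx: "\<forall>x\<in>T. path Q w x x"
  show "acts_as w id"
  proof (cases "\<exists>v T'. maps Q v T T' \<and> T' \<inter> orb n = {}")
    case True
    then obtain v T' where "maps Q v T T'" "T' \<inter> orb n = {}" by blast
    \<comment> \<open>Splitting against the empty word replaces the target by the exact image, which
      has three points.\<close>
    then obtain T' where v: "card T' = 3" "maps Q v T T'" "T' \<inter> orb n = {}"
    proof -
      obtain T1 where "card T1 = 3" "maps Q v T T1" "maps Q [] T1 T'"
        using maps_split[OF valid_Q T, of v "[]" T'] \<open>maps Q v T T'\<close> by auto
      then show thesis using that[of T1] \<open>T' \<inter> orb n = {}\<close> by (auto simp: maps_def)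
    qed
    obtain w' where w': "\<And>M. model M \<Longrightarrow> ev M w' = ev M (winv v @ w @ v)"
      "\<And>x y. x \<notin> orb n \<Longrightarrow> y \<notin> orb n \<Longrightarrow> path Q (winv v @ w @ v) x y \<Longrightarrow> path P w' x y"
      using reduce[of "winv v @ w @ v"] by blast
    have "path P w' y y" if y: "y \<in> T'" for y
    proof -
      obtain x where "x \<in> T" "path Q v x y" using maps_onto[OF valid_Q T v(1,2) y] by blast
      then have "path Q (winv v @ w @ v) y y" using fx unfolding path_append path_winv by blast
      then show ?thesis using w'(2) y v(3) by blast
    qed
    then have "acts_as w' id" using free_P v(1) unfolding free_def by blast
    then have "acts_as (winv v @ w @ v) id" using w'(1) by (simp add: acts_as_def)
    then show ?thesis by (rule acts_as_conj)
  next
    case False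
    have "maps Q w T T" using fx by (auto simp: maps_def)
    then have "plain w" using trapped[OF T] False by blast
    then obtain f where f: "f \<in> dih" "acts_as w f" "\<And>P x y. path P w x y \<longleftrightarrow> y = f x"
      using plain_dih by metis
    have "maps Q [] T T" by (simp add: maps_def)
    then obtain x where x: "x \<in> T" "x \<in> orb n" using False by blast
    then obtain b c where "x = F n b c" by (auto simp: orb_def)
    moreover have "f x = x" using fx x f(3) by metis
    ultimately have "f = id" using dih_free[OF f(1), of id n b c] by (simp add: dih_def)
    then show ?thesis using f by simp
  qed
qed

lemma path_P_orb: "path P w x y \<Longrightarrow> x \<in> orb n \<longleftrightarrow> y \<in> orb n"
proof (induction w arbitrary: x)
  case (Cons l w)
  then obtain z where z: "step P l x z" "path P w z y" by auto
  have "z \<in> orb n \<longleftrightarrow> x \<in> orb n"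
  proof (cases l)
    case (Ge g' e')
    then show ?thesis using z(1) step_P_orb by blast
  qed (use plain_step[OF _ z(1)] in \<open>auto simp: plain_def\<close>)
  then show ?case using Cons.IH[OF z(2)] by simp
qed auto

text \<open>A triple that can leave the new orbit keeps its alternative from \<open>P\<close>, since
  loops at an old tame triple reduce to \<open>P\<close>. Any other triple admits only plain
  words.\<close>

lemma stage_Q: "stage Q"
proof -
  have "reach Q T base \<or> (\<exists>T1 k. reach Q T T1 \<and> tame Q T1 k)" if T: "card T = 3" for T
  proof (cases "\<exists>v T'. maps Q v T T' \<and> T' \<inter> orb n = {}")
    case True
    then obtain v T'' where v'': "maps Q v T T''" "T'' \<inter> orb n = {}" by blast
    obtain T' where T': "card T' = 3" "maps Q v T T'" "maps Q [] T' T''"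
      using maps_split[OF valid_Q T, of v "[]" T''] v'' by auto
    then have old: "T' \<inter> orb n = {}" using v''(2) by (auto simp: maps_def)
    have r: "reach Q T T'" using T'(2) by (auto simp: reach_def)
    consider "reach P T' base" | T1 k where "reach P T' T1" "tame P T1 k"
      using stage T'(1) by (auto simp: stage_def)
    then show ?thesis
    proof cases
      case 1
      then show ?thesis using reach_mono[of P T' base Q] P_le_Q reach_trans[OF r] by blast
    next
      case 2
      then obtain u where u: "maps P u T' T1" by (auto simp: reach_def)
      have T1: "card T1 = 3" using 2 by (simp add: tame_def)
      have old1: "y \<notin> orb n" if "y \<in> T1" for y
        using maps_onto[OF valid_P T'(1) T1 u that] path_P_orb old by blast
      have "tame Q T1 k" unfolding tame_def
      proof (intro conjI allI impI)
        show "card T1 = 3" "act k ` T1 \<subseteq> T1" using 2 by (auto simp: tame_def)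
        fix v assume v: "maps Q v T1 T1"
        obtain v' where v': "\<And>M. model M \<Longrightarrow> ev M v' = ev M v"
          "\<And>x y. x \<notin> orb n \<Longrightarrow> y \<notin> orb n \<Longrightarrow> path Q v x y \<Longrightarrow> path P v' x y"
          using reduce[of v] by blast
        have m: "maps P v' T1 T1" using v v'(2) old1 unfolding maps_def by blast
        obtain h where h: "h \<in> cyc k" "acts_as v' h" "\<And>x. x \<in> T1 \<Longrightarrow> path P v' x (h x)"
          using 2(2) m unfolding tame_def by blast
        have "acts_as v h" using h(2) v'(1) by (simp add: acts_as_def)
        moreover have "path Q v x (h x)" if x: "x \<in> T1" for x
        proof -
          obtain y where y: "y \<in> T1" "path Q v x y" using v x unfolding maps_def by blast
          then have "path P v' x y" using v'(2) old1 x by blast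
          then have "y = h x" using h(3)[OF x] path_fun[OF valid_P] by blast
          then show ?thesis using y by simp
        qed
        ultimately show "\<exists>h\<in>cyc k. acts_as v h \<and> (\<forall>x\<in>T1. path Q v x (h x))" using h(1) by blast
      qed
      then show ?thesis using 2(1) reach_mono[of P T' T1 Q] P_le_Q reach_trans[OF r] by blast
    qed
  next
    case False
    have "T \<noteq> base"
    proof
      assume "T = base"
      then have "maps Q [] T base" "base \<inter> orb n = {}" by (auto simp: maps_def orb_def)
      then show False using False by blast
    qed
    then show ?thesis using plain_stabilizer[OF valid_Q T] trapped[OF T] False by blast
  qed
  then show ?thesis using valid_Q free_Q by (simp add: stage_def)
qed

end

subsection \<open>Permutation groups with involutions fixing one point\<close>

text \<open>The properties of the limit group from which the theorem follows, separated from its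
  construction. Countability of the points permits coding by natural numbers.\<close>

locale involutive_permutations =
  fixes S :: "('a :: countable \<Rightarrow> 'a) set" and c0 c1 c2 :: 'a
  assumes bij: "g \<in> S \<Longrightarrow> bij g" and id: "id \<in> S" and comp: "g \<in> S \<Longrightarrow> h \<in> S \<Longrightarrow> g \<circ> h \<in> S"
    and inverse: "g \<in> S \<Longrightarrow> inv_into UNIV g \<in> S" and distinct: "distinct [c0, c1, c2]"
    and transitive: "distinct [x1, x2, x3] \<Longrightarrow> \<exists>g \<in> S. g c0 = x1 \<and> g c1 = x2 \<and> g c2 = x3"
    and free: "g \<in> S \<Longrightarrow> distinct [x1, x2, x3] \<Longrightarrow> g x1 = x1 \<Longrightarrow> g x2 = x2 \<Longrightarrow> g x3 = x3 \<Longrightarrow> g = id"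
    and involution: "g \<in> S \<Longrightarrow> g \<circ> g = id \<Longrightarrow> x \<noteq> y \<Longrightarrow> g x = x \<Longrightarrow> g y = y \<Longrightarrow> g = id"
    and noncommuting: "\<exists>i \<in> S. \<exists>j \<in> S. i x = x \<and> j x = x \<and> i \<circ> i = id \<and> j \<circ> j = id \<and> i \<circ> j \<noteq> j \<circ> i"
begin

lemma inv_simps [simp]:
  assumes "g \<in> S"
  shows "inv_into UNIV g (g x) = x" "g (inv_into UNIV g x) = x"
  using bij[OF assms] by (auto simp: bij_is_inj surj_f_inv_f bij_is_surj)

lemma sharp:
  assumes "distinct [x1, x2, x3]" "distinct [y1, y2, y3]"
  shows "\<exists>!g. g \<in> S \<and> g x1 = y1 \<and> g x2 = y2 \<and> g x3 = y3"
proof -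
  obtain g where g: "g \<in> S" "g c0 = x1" "g c1 = x2" "g c2 = x3" using transitive[OF assms(1)] by blast
  obtain h where h: "h \<in> S" "h c0 = y1" "h c1 = y2" "h c2 = y3" using transitive[OF assms(2)] by blast
  show ?thesis
  proof (rule ex1I[of _ "h \<circ> inv_into UNIV g"])
    show "h \<circ> inv_into UNIV g \<in> S \<and> (h \<circ> inv_into UNIV g) x1 = y1 \<and> (h \<circ> inv_into UNIV g) x2 = y2 \<and>
        (h \<circ> inv_into UNIV g) x3 = y3"
      using g h comp inverse inv_simps(1)[OF g(1)] by (metis comp_apply)
    fix k assume k: "k \<in> S \<and> k x1 = y1 \<and> k x2 = y2 \<and> k x3 = y3"
    have "inv_into UNIV h \<circ> (k \<circ> g) = id"
    proof (rule free[OF _ distinct])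
      show "inv_into UNIV h \<circ> (k \<circ> g) \<in> S" by (rule comp[OF inverse[OF h(1)] comp[OF conjunct1[OF k] g(1)]])
      show "(inv_into UNIV h \<circ> (k \<circ> g)) c0 = c0" "(inv_into UNIV h \<circ> (k \<circ> g)) c1 = c1"
        "(inv_into UNIV h \<circ> (k \<circ> g)) c2 = c2"
        using g k h inv_simps(1)[OF h(1), of c0] inv_simps(1)[OF h(1), of c1]
          inv_simps(1)[OF h(1), of c2] by simp_all
    qed
    then have *: "inv_into UNIV h (k (g z)) = z" for z by (metis comp_apply id_apply)
    have "k z = h (inv_into UNIV g z)" for z
      using *[of "inv_into UNIV g z"] g(1) h(1) by (metis inv_simps(2))
    then show "k = h \<circ> inv_into UNIV g" by auto
  qed
qed

text \<open>
  A nontrivial abelian normal subgroup \<open>N\<close> of a point stabilizer acts regularly on the remaining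
  points. If an involution \<open>i\<close> agrees with \<open>n \<in> N\<close> at one of them then \<open>inv n \<circ> i\<close> has square in \<open>N\<close> and
  a second fixed point, hence is an involution with two fixed points and so trivial. Thus \<open>N\<close> contains
  all involutions of the stabilizer, and these would commute.
\<close>

lemma no_abelian_normal:
  assumes N: "N \<subseteq> {g \<in> S. g x = x}" and N_comp: "\<And>m n. m \<in> N \<Longrightarrow> n \<in> N \<Longrightarrow> m \<circ> n \<in> N"
    and N_inv: "\<And>n. n \<in> N \<Longrightarrow> inv_into UNIV n \<in> N"
    and N_normal: "\<And>n h. n \<in> N \<Longrightarrow> h \<in> S \<Longrightarrow> h x = x \<Longrightarrow> h \<circ> n \<circ> inv_into UNIV h \<in> N"
    and N_comm: "\<And>m n. m \<in> N \<Longrightarrow> n \<in> N \<Longrightarrow> m \<circ> n = n \<circ> m"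
    and n0: "n0 \<in> N"
  shows "n0 = id"
proof (rule ccontr)
  assume "n0 \<noteq> id"
  then obtain y0 where y0: "n0 y0 \<noteq> y0" by (metis ext id_apply)
  have NS: "n \<in> S" "n x = x" if "n \<in> N" for n using N that by auto
  have ne: "y0 \<noteq> x" "n0 y0 \<noteq> x" using y0 NS[OF n0] bij[OF NS(1)[OF n0]] by (metis bij_pointE)+
  \<comment> \<open>Conjugates of \<open>n0\<close> suffice, as the stabilizer of \<open>x\<close>
    is 2-transitive on the other points.\<close>
  have move: "\<exists>n\<in>N. n y = y'" if y: "y \<noteq> x" "y' \<noteq> x" "y \<noteq> y'" for y y'
  proof -
    have "distinct [x, y0, n0 y0]" "distinct [x, y, y']" using y ne y0 by auto
    then obtain h where h: "h \<in> S" "h x = x" "h y0 = y" "h (n0 y0) = y'" using sharp by blast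
    have "(h \<circ> n0 \<circ> inv_into UNIV h) y = y'" using h inv_simps(1)[OF h(1), of y0] by simp
    then show ?thesis using N_normal[OF n0 h(1,2)] by blast
  qed
  \<comment> \<open>An element fixing \<open>y0\<close> commutes with one that moves
    \<open>y0\<close> to \<open>y\<close>, and therefore fixes \<open>y\<close> too.\<close>
  have regular: "m = id" if m: "m \<in> N" "m y0 = y0" for m
  proof
    fix y
    show "m y = id y"
    proof (cases "y = x \<or> y = y0")
      case True
      then show ?thesis using m NS by auto
    next
      case False
      then obtain n where n: "n \<in> N" "n y0 = y" using move[of y0 y] ne by auto
      have "m (n y0) = n (m y0)" using N_comm[OF m(1) n(1)] by (metis comp_apply)
      then show ?thesis using n m by simp
    qed
  qed
  have invol: "i \<in> N" if i: "i \<in> S" "i x = x" "i \<circ> i = id" "i \<noteq> id" for i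
  proof -
    have ii: "i (i z) = z" for z using i(3) by (metis comp_apply id_apply)
    have "i y0 \<noteq> y0" using involution[OF i(1,3), of x y0] i ne by auto
    moreover have "i y0 \<noteq> x" using ii i(2) ne(1) by metis
    ultimately obtain n where n: "n \<in> N" "n y0 = i y0" using move[of y0 "i y0"] ne by auto
    define n' where "n' = inv_into UNIV n"
    have n': "n' \<in> N" "n' (n z) = z" "n (n' z) = z" for z
      using N_inv[OF n(1)] NS(1)[OF n(1)] by (auto simp: n'_def)
    define k where "k = n' \<circ> i"
    have k: "k \<in> S" "k x = x" "k y0 = y0" using comp NS[OF n'(1)] i n n' by (auto simp: k_def) (metis n'(2))
    \<comment> \<open>Thus \<open>i \<circ> n' \<circ> i\<close> is a conjugate of
      \<open>n'\<close>, and \<open>k \<circ> k\<close> is a product of two elements of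
      \<open>N\<close>.\<close>
    have "inv_into UNIV i = i" using ii by (intro inv_unique_comp) auto
    then have "n' \<circ> (i \<circ> n' \<circ> i) \<in> N" using N_comp N_normal[OF n'(1) i(1,2)] n'(1) by simp
    then have "k \<circ> k \<in> N" by (simp add: k_def o_assoc)
    then have "k \<circ> k = id" using regular k by simp
    then have "k = id" using involution[OF k(1), of x y0] k ne by auto
    then have "n' (i z) = z" for z by (metis k_def comp_apply id_apply)
    then have "i = n" using n'(3) by (metis ext)
    then show ?thesis using n by simp
  qed
  obtain i j where ij: "i \<in> S" "j \<in> S" "i x = x" "j x = x" "i \<circ> i = id" "j \<circ> j = id" "i \<circ> j \<noteq> j \<circ> i"
    using noncommuting by blast
  then have "i \<noteq> id" "j \<noteq> id" by auto
  with ij show False using invol[of i] invol[of j] N_comm[of i j] by auto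
qed

section \<open>Coding the permutation group by natural numbers\<close>

definition code :: "('a \<Rightarrow> 'a) \<Rightarrow> nat" where "code g = to_nat (g c0, g c1, g c2)"

definition dec :: "nat \<Rightarrow> 'a \<Rightarrow> 'a" where "dec = inv_into S code"

definition G :: "nat monoid" where
  "G = \<lparr>carrier = code ` S, monoid.mult = (\<lambda>m n. code (dec m \<circ> dec n)), one = code id\<rparr>"

definition \<Omega> :: "nat set" where "\<Omega> = range (to_nat :: 'a \<Rightarrow> nat)"

text \<open>Elements of \<open>BijGroup\<close> are extensional on \<open>\<Omega>\<close>, hence
  the restricted abstraction.\<close>

definition \<phi> :: "nat \<Rightarrow> nat \<Rightarrow> nat" where "\<phi> m = (\<lambda>n \<in> \<Omega>. to_nat (dec m (from_nat n)))"

text \<open>By sharpness a permutation in \<open>S\<close> is determined by its values at the three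
  reference points, which are all that \<open>code\<close> records.\<close>

lemma inj_code: "inj_on code S"
proof (rule inj_onI)
  fix g h assume gh: "g \<in> S" "h \<in> S" "code g = code h"
  then have eq: "g c0 = h c0" "g c1 = h c1" "g c2 = h c2" by (auto simp: code_def)
  have "distinct [h c0, h c1, h c2]" using distinct bij[OF gh(2)] by (auto dest: bij_is_inj injD)
  then show "g = h" using sharp[OF distinct, of "h c0" "h c1" "h c2"] gh eq by blast
qed

lemma dec_code [simp]: "g \<in> S \<Longrightarrow> dec (code g) = g"
  by (simp add: dec_def inj_code)

lemma carrier_G: "carrier G = code ` S" by (simp add: G_def)

lemma mult_G: "g \<in> S \<Longrightarrow> h \<in> S \<Longrightarrow> code g \<otimes>\<^bsub>G\<^esub> code h = code (g \<circ> h)" by (simp add: G_def)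

lemma one_G: "\<one>\<^bsub>G\<^esub> = code id" by (simp add: G_def)

lemma inv_comp: "g \<in> S \<Longrightarrow> inv_into UNIV g \<circ> g = id" "g \<in> S \<Longrightarrow> g \<circ> inv_into UNIV g = id"
  by auto

lemma group_G: "group G"
proof (rule groupI)
  fix x assume "x \<in> carrier G"
  then obtain g where "g \<in> S" "x = code g" by (auto simp: carrier_G)
  then show "\<exists>y\<in>carrier G. y \<otimes>\<^bsub>G\<^esub> x = \<one>\<^bsub>G\<^esub>"
    using inverse by (intro bexI[of _ "code (inv_into UNIV g)"]) (auto simp: carrier_G mult_G one_G inv_comp)
qed (auto simp: carrier_G mult_G one_G id comp o_assoc)

lemma inv_G: "g \<in> S \<Longrightarrow> inv\<^bsub>G\<^esub> (code g) = code (inv_into UNIV g)"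
  using group.inv_equality[OF group_G, of "code (inv_into UNIV g)" "code g"] inverse
  by (auto simp: carrier_G mult_G one_G inv_comp)

lemma phi_code: "g \<in> S \<Longrightarrow> \<phi> (code g) (to_nat x) = to_nat (g x)"
  by (simp add: \<phi>_def \<Omega>_def)

lemma action: "group_action G \<Omega> \<phi>"
  unfolding group_action_def group_hom_def group_hom_axioms_def
proof (intro conjI group_G group_BijGroup homI)
  have Bij: "\<phi> (code g) \<in> Bij \<Omega>" if g: "g \<in> S" for g
  proof -
    have "bij_betw (\<phi> (code g)) \<Omega> \<Omega>"
      unfolding bij_betw_def
    proof
      show "inj_on (\<phi> (code g)) \<Omega>"
        using bij[OF g] by (auto simp: inj_on_def \<Omega>_def phi_code[OF g] dest: bij_is_inj injD)
      show "\<phi> (code g) ` \<Omega> = \<Omega>"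
      proof
        show "\<Omega> \<subseteq> \<phi> (code g) ` \<Omega>"
        proof
          fix n assume "n \<in> \<Omega>"
          then obtain x where "n = to_nat (x :: 'a)" by (auto simp: \<Omega>_def)
          then have "n = \<phi> (code g) (to_nat (inv_into UNIV g x))" using g by (simp add: phi_code)
          then show "n \<in> \<phi> (code g) ` \<Omega>" by (auto simp: \<Omega>_def)
        qed
      qed (auto simp: \<Omega>_def phi_code[OF g])
    qed
    then show ?thesis by (auto simp: Bij_def \<phi>_def)
  qed
  fix m assume "m \<in> carrier G"
  then obtain g where g: "g \<in> S" "m = code g" by (auto simp: carrier_G)
  then show "\<phi> m \<in> carrier (BijGroup \<Omega>)" using Bij by (simp add: BijGroup_def)
  fix n assume "n \<in> carrier G"
  then obtain h where h: "h \<in> S" "n = code h" by (auto simp: carrier_G)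
  have "\<phi> (code (g \<circ> h)) = compose \<Omega> (\<phi> (code g)) (\<phi> (code h))"
  proof
    fix k
    show "\<phi> (code (g \<circ> h)) k = compose \<Omega> (\<phi> (code g)) (\<phi> (code h)) k"
    proof (cases "k \<in> \<Omega>")
      case True
      then obtain x where "k = to_nat (x :: 'a)" by (auto simp: \<Omega>_def)
      then show ?thesis using True g h comp by (simp add: phi_code compose_def)
    qed (simp add: \<phi>_def compose_def)
  qed
  then show "\<phi> (m \<otimes>\<^bsub>G\<^esub> n) = \<phi> m \<otimes>\<^bsub>BijGroup \<Omega>\<^esub> \<phi> n"
    using g h Bij by (simp add: BijGroup_def mult_G)
qed

lemma sharply_3_transitive: "sharply_3_transitive_action G \<Omega> \<phi>"
proof -
  interpret group_action G \<Omega> \<phi> by (rule action)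
  show ?thesis
  proof
    show "\<exists>a\<in>\<Omega>. \<exists>b\<in>\<Omega>. \<exists>c\<in>\<Omega>. distinct [a, b, c]"
      using distinct by (intro bexI[of _ "to_nat c0"] bexI[of _ "to_nat c1"] bexI[of _ "to_nat c2"])
        (auto simp: \<Omega>_def)
    fix x1 x2 x3 y1 y2 y3
    assume xy: "{x1, x2, x3} \<subseteq> \<Omega>" "distinct [x1, x2, x3]" "{y1, y2, y3} \<subseteq> \<Omega>" "distinct [y1, y2, y3]"
    obtain a1 a2 a3 where a: "x1 = to_nat (a1 :: 'a)" "x2 = to_nat (a2 :: 'a)" "x3 = to_nat (a3 :: 'a)"
      using xy(1) by (auto simp: \<Omega>_def)
    obtain b1 b2 b3 where b: "y1 = to_nat (b1 :: 'a)" "y2 = to_nat (b2 :: 'a)" "y3 = to_nat (b3 :: 'a)"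
      using xy(3) by (auto simp: \<Omega>_def)
    have "\<exists>!g. g \<in> S \<and> g a1 = b1 \<and> g a2 = b2 \<and> g a3 = b3" using sharp xy a b by auto
    then show "\<exists>!m. m \<in> carrier G \<and> \<phi> m x1 = y1 \<and> \<phi> m x2 = y2 \<and> \<phi> m x3 = y3"
      unfolding a b carrier_G by (auto simp: phi_code) (metis phi_code to_nat_split)+
  qed
qed

lemma stabilizer_no_abelian_normal:
  assumes "k \<in> \<Omega>"
  shows "\<not> has_nontrivial_abelian_normal_subgroup (G\<lparr>carrier := stabilizer G \<phi> k\<rparr>)"
proof
  let ?H = "G\<lparr>carrier := stabilizer G \<phi> k\<rparr>"
  obtain x where k: "k = to_nat (x :: 'a)" using assms by (auto simp: \<Omega>_def)
  have stab: "stabilizer G \<phi> k = code ` {g \<in> S. g x = x}"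
    by (auto simp: stabilizer_def carrier_G k phi_code)
  have subgroup: "subgroup (stabilizer G \<phi> k) G" using group_action.stabilizer_subgroup[OF action assms] .
  assume "has_nontrivial_abelian_normal_subgroup ?H"
  then obtain M where M: "M \<lhd> ?H" "comm_group (?H\<lparr>carrier := M\<rparr>)" "M \<noteq> {\<one>\<^bsub>?H\<^esub>}"
    by (auto simp: has_nontrivial_abelian_normal_subgroup_def)
  interpret M: normal M ?H by (rule M(1))
  have sub: "subgroup M ?H" by (rule M.subgroup_axioms)
  interpret C: comm_group "?H\<lparr>carrier := M\<rparr>" by (rule M(2))
  have MS: "M \<subseteq> code ` {g \<in> S. g x = x}" using M.subset stab by simp
  define N where "N = {g \<in> S. code g \<in> M}"
  have M_eq: "M = code ` N" using MS by (auto simp: N_def)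
  have inv_H: "inv\<^bsub>?H\<^esub> (code g) = code (inv_into UNIV g)" if "g \<in> S" "g x = x" for g
    using group.m_inv_consistent[OF group_G subgroup, of "code g"] that inv_G stab by auto
  have "n = id" if "n \<in> N" for n
  proof (rule no_abelian_normal[of N x])
    show N: "N \<subseteq> {g \<in> S. g x = x}"
    proof
      fix g assume g: "g \<in> N"
      then obtain h where "h \<in> S" "h x = x" "code g = code h" using MS by (auto simp: N_def)
      then show "g \<in> {g \<in> S. g x = x}" using g inj_code by (auto simp: N_def inj_on_def)
    qed
    fix m n assume mn: "m \<in> N" "n \<in> N"
    then show "m \<circ> n \<in> N" using subgroup.m_closed[OF sub, of "code m" "code n"] by (auto simp: N_def mult_G comp)
    have "code m \<otimes>\<^bsub>G\<^esub> code n = code n \<otimes>\<^bsub>G\<^esub> code m" using C.m_comm[of "code m" "code n"] mn by (simp add: N_def)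
    then have "code (m \<circ> n) = code (n \<circ> m)" using mn by (simp add: N_def mult_G)
    then show "m \<circ> n = n \<circ> m" using mn comp inj_code by (simp add: N_def inj_on_def)
  next
    fix n assume n: "n \<in> N"
    then have nx: "n x = x" "n \<in> S" "code n \<in> M" using MS inj_code by (auto simp: N_def inj_on_def)
    show "inv_into UNIV n \<in> N" using subgroup.m_inv_closed[OF sub nx(3)] inv_H nx inverse by (simp add: N_def)
    fix h assume h: "h \<in> S" "h x = x"
    have "code h \<otimes>\<^bsub>?H\<^esub> code n \<otimes>\<^bsub>?H\<^esub> inv\<^bsub>?H\<^esub> (code h) \<in> M"
      using M.inv_op_closed2[of "code h" "code n"] h nx stab by auto
    then show "h \<circ> n \<circ> inv_into UNIV h \<in> N" using inv_H[OF h] h nx comp inverse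
      by (simp add: N_def mult_G)
  qed (rule that)
  then have "M \<subseteq> {\<one>\<^bsub>?H\<^esub>}" using M_eq by (auto simp: one_G)
  then show False using M(3) subgroup.one_closed[OF sub] by auto
qed

end

subsection \<open>The limit group\<close>

text \<open>The value 0 on the base is a placeholder; it can at most exclude orbit 0 from the choice
  of a fresh orbit.\<close>

fun orb_index :: "pt \<Rightarrow> nat" where
  "orb_index (B c) = 0" | "orb_index (F n b c) = n"

lemma fresh_orbit:
  assumes "valid P"
  obtains n where "\<And>g x y. (x, y) \<in> P g \<Longrightarrow> x \<notin> orb n \<and> y \<notin> orb n" "a \<notin> orb n"
proof -
  let ?S = "{(g, x, y). (x, y) \<in> P g - seed g}"
  have "finite (orb_index ` (insert a (\<Union>(g, x, y)\<in>?S. {x, y})))"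
    using assms by (auto simp: valid_def)
  then obtain n where n: "n \<notin> orb_index ` (insert a (\<Union>(g, x, y)\<in>?S. {x, y}))"
    using ex_new_if_finite[OF infinite_UNIV_nat] by blast
  show thesis
  proof (rule that[of n])
    show "a \<notin> orb n" using n by (auto simp: orb_def)
    fix g x y assume xy: "(x, y) \<in> P g"
    show "x \<notin> orb n \<and> y \<notin> orb n"
    proof (cases "(x, y) \<in> seed g")
      case True
      then show ?thesis by (auto simp: seed_def orb_def split: if_splits)
    next
      case False
      then have "(g, x, y) \<in> ?S" using xy by simp
      then have "x \<in> (\<Union>(g, x, y)\<in>?S. {x, y})" "y \<in> (\<Union>(g, x, y)\<in>?S. {x, y})" by blast+
      then have "orb_index x \<noteq> n" "orb_index y \<noteq> n" using n by blast+
      then show ?thesis by (auto simp: orb_def)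
    qed
  qed
qed

lemma stage_extend:
  assumes "stage P"
  obtains Q where "stage Q" "\<And>g. P g \<subseteq> Q g" "\<exists>y. step Q (Ge g e) a y"
proof (cases "\<exists>y. step P (Ge g e) a y")
  case True
  then show ?thesis using that assms by blast
next
  case False
  obtain n where n: "\<And>g x y. (x, y) \<in> P g \<Longrightarrow> x \<notin> orb n \<and> y \<notin> orb n" "a \<notin> orb n"
    using fresh_orbit assms unfolding stage_def by blast
  interpret extend_generator P g e a n
    using assms False n by unfold_locales blast+
  have "(a, p) \<in> E" unfolding E_def using cyc_id by (intro image_eqI[of _ _ id]) auto
  then show ?thesis using that stage_Q P_le_Q step_Q by blast
qed

text \<open>A triple stable under \<open>turn\<close> is one of its three-point orbits. One stable
  under \<open>flip\<close> contains a fixed point by parity, necessarily \<open>B C0\<close>, and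
  besides it a swapped pair. Either way it looks like the base under \<open>act k\<close>.\<close>

lemma equivariant_bij:
  assumes T: "card T = 3" "act k ` T \<subseteq> T"
  obtains f where "bij_betw f base T" "\<And>x. x \<in> base \<Longrightarrow> f (act k x) = act k (f x)"
proof -
  have bij: "bij_betw f base T" if "f ` base \<subseteq> T" "inj_on f base" for f
    using that T card_subset_eq[OF card3_finite[OF T(1)], of "f ` base"]
    by (simp add: bij_betw_def card_image)
  show thesis
  proof (cases k)
    case Triv
    obtain f where "bij_betw f base T"
      using finite_same_card_bij[of base T] T card3_finite by auto
    then show thesis using that Triv by simp
  next
    case Rota
    obtain a where a: "a \<in> T" using T by fastforce
    have t: "turn x \<in> T" if "x \<in> T" for x using T(2) Rota that by auto
    define f where "f = (\<lambda>x. if x = B C0 then a else if x = B C1 then turn a else turn (turn a))"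
    show thesis
    proof (rule that[of f])
      show "bij_betw f base T"
        by (rule bij) (use a t turn_neq[of a] in \<open>auto simp: base_def f_def inj_on_def eq_commute[of a]\<close>)
    qed (auto simp: base_def f_def Rota)
  next
    case Refl
    have t: "flip x \<in> T" if "x \<in> T" for x using T(2) Refl that by auto
    obtain u v w where uvw: "T = {u, v, w}" "u \<noteq> v" "v \<noteq> w" "u \<noteq> w"
      using T(1) by (metis card_3_iff)
    have z: "B C0 \<in> T"
    proof (rule ccontr)
      assume "B C0 \<notin> T"
      then have "flip u \<noteq> u" "flip v \<noteq> v" "flip w \<noteq> w" using uvw by auto
      then show False using t[of u] t[of v] t[of w] uvw by auto
    qed
    obtain a where a: "a \<in> T" "a \<noteq> B C0" using uvw by auto
    have fa: "flip a \<noteq> a" "flip a \<noteq> B C0" using a flip_inject[of a "B C0"] by auto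
    define f where "f = (\<lambda>x. if x = B C0 then B C0 else if x = B C1 then a else flip a)"
    show thesis
    proof (rule that[of f])
      show "bij_betw f base T"
        by (rule bij) (use a t z fa in \<open>auto simp: base_def f_def inj_on_def eq_commute[of a]\<close>)
    qed (auto simp: base_def f_def Refl)
  qed
qed

lemma unused_generator:
  assumes "valid P"
  obtains n where "P (k, n) \<subseteq> seed (k, n)"
proof -
  let ?S = "{(g, x, y). (x, y) \<in> P g - seed g}"
  have "finite ((snd \<circ> fst) ` ?S)" using assms by (auto simp: valid_def)
  then obtain n where n: "n \<notin> (snd \<circ> fst) ` ?S"
    using ex_new_if_finite[OF infinite_UNIV_nat] by blast
  have "xy \<in> seed (k, n)" if xy: "xy \<in> P (k, n)" for xy
  proof (rule ccontr)
    assume "xy \<notin> seed (k, n)"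
    then have "((k, n), xy) \<in> ?S" using xy by (cases xy) auto
    then have "(snd \<circ> fst) ((k, n), xy) \<in> (snd \<circ> fst) ` ?S" by (rule imageI)
    then show False using n by simp
  qed
  then show thesis using that by blast
qed

lemma stage_reach:
  assumes P: "stage P" and T: "card T = 3"
  obtains Q where "stage Q" "\<And>g. P g \<subseteq> Q g" "reach Q T base"
proof (cases "reach P T base")
  case True
  then show ?thesis using that P by blast
next
  case False
  have valid: "valid P" using P by (simp add: stage_def)
  obtain T1 k where r: "reach P T T1" "tame P T1 k" using P T False unfolding stage_def by blast
  obtain n where n: "P (k, n) \<subseteq> seed (k, n)" using unused_generator[OF valid] .
  obtain f where f: "bij_betw f base T1" "\<And>x. x \<in> base \<Longrightarrow> f (act k x) = act k (f x)"
    using equivariant_bij[of T1 k] r(2) unfolding tame_def by blast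
  have "\<not> reach P T1 base" using False reach_trans[OF r(1)] by blast
  then interpret glue_base P T1 k n f using P r n f by unfold_locales auto
  have "reach Q T base" using reach_trans[OF reach_mono[OF r(1) P_le_Q] reach_T1] .
  then show ?thesis using that stage_Q P_le_Q by blast
qed

text \<open>
  The generator \<open>t = (Triv, 0)\<close> makes \<open>t \<circ> flip \<circ> inv t\<close> an involution fixing \<open>B C0\<close> that swaps
  \<open>F 0 False C0\<close> with \<open>F 1 False C0\<close> but sends the flip of the former to \<open>F 3 False C0\<close>, so it does not
  commute with the flip.
\<close>

lemma start:
  obtains P where "stage P"
    "{(B C0, B C0), (B C1, F 0 False C0), (B C2, F 1 False C0), (F 2 False C0, F 0 True C0),
      (F 2 True C0, F 3 False C0)} \<subseteq> P (Triv, 0)"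
proof -
  define T1 where "T1 = {B C0, F 0 False C0, F 1 False C0}"
  define f where "f = (\<lambda>x. if x = B C0 then B C0 else if x = B C1 then F 0 False C0 else F 1 False C0)"
  have c: "card T1 = 3" by (simp add: T1_def)
  have dih: "f = id" if "f \<in> dih" "f (F 0 False C0) \<in> T1" for f
    using that unfolding dih_def T1_def by auto
  have "\<not> reach seed T1 base"
  proof
    assume "reach seed T1 base"
    then obtain w where w: "maps seed w T1 base" by (auto simp: reach_def)
    obtain h where h: "h \<in> dih" "\<And>P x y. path P w x y \<longleftrightarrow> y = h x"
      using plain_dih[OF seed_plain[OF c w]] by metis
    have "h (F 0 False C0) \<in> base" using w h(2) by (auto simp: maps_def T1_def)
    then show False using h(1) by (auto simp: dih_def)
  qed
  moreover have "tame seed T1 Triv" unfolding tame_def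
  proof (intro conjI allI impI)
    fix w assume w: "maps seed w T1 T1"
    obtain h where h: "h \<in> dih" "acts_as w h" "\<And>P x y. path P w x y \<longleftrightarrow> y = h x"
      using plain_dih[OF seed_plain[OF c w]] by metis
    have "h (F 0 False C0) \<in> T1" using w h(3) by (auto simp: maps_def T1_def)
    then have "h = id" using dih h(1) by blast
    then show "\<exists>h\<in>cyc Triv. acts_as w h \<and> (\<forall>x\<in>T1. path seed w x (h x))" using h by simp
  qed (use c in auto)
  moreover have "bij_betw f base T1"
    by (auto simp: bij_betw_def base_def T1_def f_def inj_on_def)
  ultimately interpret P1: glue_base seed T1 Triv 0 f
    using stage_seed by unfold_locales auto
  have P1: "P1.Q g = (if g = (Triv, 0) then {(B C0, B C0), (B C1, F 0 False C0), (B C2, F 1 False C0)} else seed g)" for g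
    unfolding P1.Q_def by (auto simp: base_def f_def)
  \<comment> \<open>Direction \<open>False\<close>: \<open>F 0 True C0\<close>, the flip of
    \<open>F 0 False C0\<close>, receives a preimage in orbit 2. The flip of this preimage then
    receives an image in orbit 3.\<close>
  interpret P2: extend_generator P1.Q "(Triv, 0)" False "F 0 True C0" 2
    using P1.stage_Q by unfold_locales (auto simp: P1 orb_def seed_def split: if_splits)
  have P2: "P2.Q g = (if g = (Triv, 0) then insert (F 2 False C0, F 0 True C0) (P1.Q g) else P1.Q g)" for g
    unfolding P2.Q_def by (auto simp: P2.E_def P2.p_def)
  interpret P3: extend_generator P2.Q "(Triv, 0)" True "F 2 True C0" 3
    using P2.stage_Q by unfold_locales (auto simp: P2 P1 orb_def seed_def split: if_splits)
  have "P3.Q (Triv, 0) = insert (F 2 True C0, F 3 False C0) (P2.Q (Triv, 0))"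
    unfolding P3.Q_def by (auto simp: P3.E_def P3.p_def)
  then show thesis using that[OF P3.stage_Q] by (simp add: P2 P1)
qed

section \<open>The limit of a chain of stages\<close>

type_synonym task = "((kind \<times> nat) \<times> bool \<times> pt) + (pt \<times> pt \<times> pt)"

text \<open>The first kind of task makes the generators total and surjective, the second brings
  every triple to the base. Once completed, a task stays completed in larger partial
  permutations.\<close>

fun complete :: "task \<Rightarrow> partial \<Rightarrow> bool" where
  "complete (Inl (g, e, a)) P \<longleftrightarrow> (\<exists>y. step P (Ge g e) a y)"
| "complete (Inr (x, y, z)) P \<longleftrightarrow> (card {x, y, z} = 3 \<longrightarrow> reach P {x, y, z} base)"

lemma stage_complete:
  assumes "stage P"
  shows "\<exists>Q. stage Q \<and> (\<forall>g. P g \<subseteq> Q g) \<and> complete t Q"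
proof (cases t)
  case (Inl u)
  obtain g e a where "u = (g, e, a)" by (cases u)
  then show ?thesis using stage_extend[OF assms, of g e a] Inl by (metis complete.simps(1))
next
  case (Inr u)
  obtain x y z where "u = (x, y, z)" by (cases u)
  then show ?thesis using stage_reach[OF assms, of "{x, y, z}"] Inr assms
    by (metis complete.simps(2) order_refl)
qed

lemma limit_model:
  assumes P: "stage P"
  obtains M where "model M" "\<And>g x y. (x, y) \<in> P g \<Longrightarrow> M g x = y"
    "\<And>T. card T = 3 \<Longrightarrow> \<exists>w. ev M w ` T \<subseteq> base"
    "\<And>w T. card T = 3 \<Longrightarrow> (\<And>x. x \<in> T \<Longrightarrow> ev M w x = x) \<Longrightarrow> ev M w = id"
proof -
  \<comment> \<open>Tasks form a countable type, and stage \<open>Suc n\<close> completes the task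
    with number \<open>n\<close>, so every task is met.\<close>
  have "\<exists>S. \<forall>n. (stage (S n) \<and> (n = 0 \<longrightarrow> S n = P)) \<and>
      ((\<forall>g. S n g \<subseteq> S (Suc n) g) \<and> complete (from_nat n) (S (Suc n)))"
  proof (rule dependent_nat_choice)
    show "\<exists>Q. stage Q \<and> (0 = (0 :: nat) \<longrightarrow> Q = P)" using P by blast
    show "\<exists>R. (stage R \<and> (Suc n = 0 \<longrightarrow> R = P)) \<and> ((\<forall>g. Q g \<subseteq> R g) \<and> complete (from_nat n) R)"
      if "stage Q \<and> (n = 0 \<longrightarrow> Q = P)" for Q n
      using stage_complete[of Q "from_nat n"] that by blast
  qed
  then obtain S where S: "\<And>n. stage (S n)" "S 0 = P" "\<And>n g. S n g \<subseteq> S (Suc n) g"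
    "\<And>n. complete (from_nat n) (S (Suc n))" by blast
  have mono: "S m g \<subseteq> S n g" if "m \<le> n" for m n g
    using lift_Suc_mono_le[of "\<lambda>n. S n g", OF S(3) that] .
  have valid: "valid (S n)" for n using S(1) by (simp add: stage_def)
  have total: "\<exists>n y. step (S n) (Ge g e) x y" for g e x
    using S(4)[of "to_nat (Inl (g, e, x) :: task)"] by (simp del: step.simps) blast
  have join: "\<exists>k. S m g \<subseteq> S k g \<and> S n g' \<subseteq> S k g'" for m n g g'
    using mono[of m "max m n"] mono[of n "max m n"] by (meson max.cobounded1 max.cobounded2)
  have unique: "y = y'" if xy: "(x, y) \<in> S m g" "(x, y') \<in> S n g" for x y y' m n g
  proof -
    obtain k where "S m g \<subseteq> S k g" "S n g \<subseteq> S k g" using join by blast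
    then have "step (S k) (Ge g True) x y" "step (S k) (Ge g True) x y'" using xy by auto
    then show ?thesis using step_inject(1)[OF valid] by blast
  qed
  have unique': "x = x'" if xy: "(x, y) \<in> S m g" "(x', y) \<in> S n g" for x x' y m n g
  proof -
    obtain k where "S m g \<subseteq> S k g" "S n g \<subseteq> S k g" using join by blast
    then have "step (S k) (Ge g True) x y" "step (S k) (Ge g True) x' y" using xy by auto
    then show ?thesis using step_inject(2)[OF valid] by blast
  qed
  have "\<forall>g x. \<exists>y n. (x, y) \<in> S n g"
  proof (intro allI)
    fix g x
    show "\<exists>y n. (x, y) \<in> S n g" using total[of g True x] by auto
  qed
  then obtain M where "\<forall>g x. \<exists>n. (x, M g x) \<in> S n g" by metis
  then have M_in: "\<exists>n. (x, M g x) \<in> S n g" for g x by blast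
  have M_eq: "M g x = y" if "(x, y) \<in> S n g" for g x y n using M_in[of x g] unique that by blast
  have model: "model M" unfolding model_def
  proof (intro allI conjI)
    fix g
    show "bij (M g)"
    proof (rule bijI)
      show "inj (M g)"
      proof (rule injI)
        fix x x' assume "M g x = M g x'"
        then show "x = x'" using M_in[of x g] M_in[of x' g] unique' by metis
      qed
      show "surj (M g)" unfolding surj_def
      proof
        fix y
        obtain x n where "(x, y) \<in> S n g" using total[of g False y] by auto
        then show "\<exists>x. y = M g x" using M_eq by metis
      qed
    qed
    fix x
    obtain n where "(x, M g x) \<in> S n g" using M_in by blast
    then have "(act (fst g) x, act (fst g) (M g x)) \<in> S n g" using valid_cyc[OF valid] cyc_act by blast
    then show "M g (act (fst g) x) = act (fst g) (M g x)" using M_eq by blast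
  qed
  have step_ev: "evl M l x = y" if "step (S n) l x y" for l x y n
  proof (cases l)
    case (Ge g e)
    have "inv_into UNIV (M g) y' = x'" if "M g x' = y'" for x' y'
      using model that by (auto simp: model_def bij_is_inj)
    moreover have "M g x = y" if e using \<open>step (S n) l x y\<close> Ge M_eq that by simp
    moreover have "M g y = x" if "\<not> e" using \<open>step (S n) l x y\<close> Ge M_eq that by simp
    ultimately show ?thesis using Ge by (cases e) auto
  qed (use that in auto)
  have path_ev: "path (S n) w x y \<Longrightarrow> ev M w x = y" for n w x y
    by (induction w arbitrary: x) (use step_ev in auto)
  have ev_path: "\<exists>n. path (S n) w x (ev M w x)" for w x
  proof (induction w arbitrary: x)
    case (Cons l w)
    have "\<exists>n z. step (S n) l x z" using total by (cases l) auto
    then obtain m where m: "step (S m) l x (evl M l x)" using step_ev by metis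
    obtain n where n: "path (S n) w (evl M l x) (ev M w (evl M l x))" using Cons by blast
    let ?k = "max m n"
    have "path (S ?k) [l] x (evl M l x)" using path_mono[of "S m" "[l]" _ _ "S ?k"] m mono[of m ?k] by simp
    moreover have "path (S ?k) w (evl M l x) (ev M w (evl M l x))"
      using path_mono[OF n, of "S ?k"] mono[of n ?k] by simp
    ultimately have "path (S ?k) (l # w) x (ev M (l # w) x)" by auto
    then show ?case by blast
  qed auto
  show thesis
  proof (rule that[OF model])
    show "M g x = y" if "(x, y) \<in> P g" for g x y using M_eq[of x y 0 g] that S(2) by simp
  next
    fix T :: "pt set" assume T: "card T = 3"
    then obtain x y z where xyz: "T = {x, y, z}" by (metis card_3_iff)
    have "reach (S (Suc (to_nat (Inr (x, y, z) :: task)))) T base"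
      using S(4)[of "to_nat (Inr (x, y, z) :: task)"] T xyz by simp
    then obtain n w where "maps (S n) w T base" by (auto simp: reach_def)
    then have "ev M w ` T \<subseteq> base" using path_ev by (fastforce simp: maps_def)
    then show "\<exists>w. ev M w ` T \<subseteq> base" by blast
  next
    fix w and T :: "pt set" assume T: "card T = 3" and fx: "\<And>x. x \<in> T \<Longrightarrow> ev M w x = x"
    have "\<forall>x\<in>T. \<exists>n. path (S n) w x x" using ev_path fx by metis
    then obtain N where N: "\<And>x. x \<in> T \<Longrightarrow> path (S (N x)) w x x" by metis
    \<comment> \<open>\<open>T\<close> is finite, so the largest of the stages involved contains all
      three paths.\<close>
    let ?n = "Max (N ` T)"
    have "path (S ?n) w x x" if "x \<in> T" for x
    proof (rule path_mono[OF N[OF that]])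
      have "N x \<le> ?n" using that card3_finite[OF T] by simp
      then show "S (N x) g \<subseteq> S ?n g" for g by (rule mono)
    qed
    then have "acts_as w id" using S(1)[of ?n] T unfolding stage_def free_def by blast
    then show "ev M w = id" using model by (simp add: acts_as_def)
  qed
qed

theorem corollary2p3:
  shows "\<exists>(G :: nat monoid) (\<Omega> :: nat set) (\<phi> :: nat \<Rightarrow> nat \<Rightarrow> nat).
           sharply_3_transitive_action G \<Omega> \<phi> \<and>
           (\<forall>x \<in> \<Omega>. \<not> has_nontrivial_abelian_normal_subgroup (G\<lparr>carrier := stabilizer G \<phi> x\<rparr>))"
proof -
  obtain P where P: "stage P"
    "{(B C0, B C0), (B C1, F 0 False C0), (B C2, F 1 False C0), (F 2 False C0, F 0 True C0),
      (F 2 True C0, F 3 False C0)} \<subseteq> P (Triv, 0)" by (rule start)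
  obtain M where M: "model M" "\<And>g x y. (x, y) \<in> P g \<Longrightarrow> M g x = y"
    "\<And>T. card T = 3 \<Longrightarrow> \<exists>w. ev M w ` T \<subseteq> base"
    "\<And>w T. card T = 3 \<Longrightarrow> (\<And>x. x \<in> T \<Longrightarrow> ev M w x = x) \<Longrightarrow> ev M w = id"
    using limit_model[OF P(1)] by blast
  let ?S = "range (ev M)"
  have inv: "inv_into UNIV (ev M w) = ev M (winv w)" for w
    using ev_winv[OF M(1), of w] by (intro inv_unique_comp) auto
  have bij: "bij g" if "g \<in> ?S" for g using that bij_ev[OF M(1)] by auto
  have comp: "g \<circ> h \<in> ?S" if "g \<in> ?S" "h \<in> ?S" for g h
    using that by (auto simp: ev_append[symmetric])
  have inverse: "inv_into UNIV g \<in> ?S" if "g \<in> ?S" for g using that inv by auto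
  have dih_S: "g \<in> ?S" if "g \<in> dih" for g
    using dih_word[OF that] M(1) unfolding acts_as_def by (metis rangeI)
  have cancel: "inv_into UNIV g (g x) = x" "g (inv_into UNIV g x) = x" if "g \<in> ?S" for g x
    using bij[OF that] by (auto simp: bij_is_inj surj_f_inv_f bij_is_surj)
  have free: "g = id" if "g \<in> ?S" "distinct [x1, x2, x3]" "g x1 = x1" "g x2 = x2" "g x3 = x3" for g x1 x2 x3
    using that M(4)[of "{x1, x2, x3}"] by auto
  have trans: "\<exists>g \<in> ?S. g (B C0) = x1 \<and> g (B C1) = x2 \<and> g (B C2) = x3"
    if x: "distinct [x1, x2, x3]" for x1 x2 x3
  proof -
    obtain w where w: "ev M w ` {x1, x2, x3} \<subseteq> base" using M(3)[of "{x1, x2, x3}"] x by auto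
    have "distinct [ev M w x1, ev M w x2, ev M w x3]"
      using x bij_ev[OF M(1), of w] by (auto dest: bij_is_inj injD)
    then obtain f where f: "f \<in> dih" "f (B C0) = ev M w x1" "f (B C1) = ev M w x2" "f (B C2) = ev M w x3"
      using dih_base_realize w by (metis image_subset_iff insertCI)
    have "inv_into UNIV (ev M w) \<circ> f \<in> ?S" by (rule comp[OF inverse[OF rangeI] dih_S[OF f(1)]])
    then show ?thesis using f cancel(1)[of "ev M w"] by (intro bexI[of _ "inv_into UNIV (ev M w) \<circ> f"]) auto
  qed
  have flip: "flip \<in> ?S" by (rule dih_S) (simp add: dih_def)
  have conj: "k \<circ> g \<circ> inv_into UNIV k \<in> ?S" if "g \<in> ?S" "k \<in> ?S" for g k
    by (rule comp[OF comp[OF that(2,1)] inverse[OF that(2)]])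
  have involution: "g = id"
    if g: "g \<in> ?S" "g \<circ> g = id" "x \<noteq> y" "g x = x" "g y = y" for g x y
  proof (rule ccontr)
    assume "g \<noteq> id"
    then obtain u where u: "g u \<noteq> u" by (metis ext id_apply)
    have gg: "g (g v) = v" for v using g(2) by (metis comp_apply id_apply)
    \<comment> \<open>When \<open>k\<close> carries the base points to \<open>x\<close>,
      \<open>u\<close> and \<open>g u\<close>, the conjugate of \<open>g\<close> by \<open>k\<close>
      acts on the base as \<open>flip\<close> does. By freeness it is \<open>flip\<close>, which
      fixes only one point.\<close>
    have "distinct [x, u, g u]" using u g(4) gg by (auto; metis)
    then obtain k where k: "k \<in> ?S" "k (B C0) = x" "k (B C1) = u" "k (B C2) = g u" using trans by blast
    let ?k' = "inv_into UNIV k"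
    have k': "?k' x = B C0" "?k' u = B C1" "?k' (g u) = B C2" using cancel(1)[OF k(1)] k by metis+
    have "flip \<circ> (?k' \<circ> g \<circ> k) = id"
    proof (rule free[of _ "B C0" "B C1" "B C2"])
      show "flip \<circ> (?k' \<circ> g \<circ> k) \<in> ?S"
        by (rule comp[OF flip comp[OF comp[OF inverse[OF k(1)] g(1)] k(1)]])
    qed (use k k' g gg in auto)
    then have *: "flip (?k' (g (k v))) = v" for v by (metis comp_apply id_apply)
    then have "flip (?k' v) = ?k' v" if "g v = v" for v using *[of "?k' v"] that cancel(2)[OF k(1)] by simp
    then have "?k' x = ?k' y" using g(4,5) by (metis flip_fixed)
    then show False using g(3) cancel(2)[OF k(1)] by metis
  qed
  have noncomm: "\<exists>i \<in> ?S. \<exists>j \<in> ?S. i x = x \<and> j x = x \<and> i \<circ> i = id \<and> j \<circ> j = id \<and> i \<circ> j \<noteq> j \<circ> i" for x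
  proof -
    define t where "t = M (Triv, 0)"
    have "t = ev M [Ge (Triv, 0) True]" by (simp add: t_def)
    then have tS: "t \<in> ?S" by blast
    have t: "t (B C0) = B C0" "t (B C1) = F 0 False C0" "t (B C2) = F 1 False C0"
      "t (F 2 False C0) = F 0 True C0" "t (F 2 True C0) = F 3 False C0"
      using M(2)[of _ _ "(Triv, 0)"] P(2) by (auto simp: t_def)
    define i where "i = t \<circ> flip \<circ> inv_into UNIV t"
    have it: "i (t v) = t (flip v)" for v using cancel(1)[OF tS] by (simp add: i_def)
    have iS: "i \<in> ?S" using conj[OF flip tS] by (simp add: i_def)
    have ii: "i (i v) = v" for v using cancel[OF tS] by (simp add: i_def)
    have i: "i (B C0) = B C0" "i (F 0 False C0) = F 1 False C0" "i (F 0 True C0) = F 3 False C0"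
      using it[of "B C0"] it[of "B C1"] it[of "F 2 False C0"] t by simp_all
    \<comment> \<open>Transitivity is stated for triples, so \<open>x\<close> is completed by two
      arbitrary points. Conjugation by \<open>k\<close> then moves both involutions from
      \<open>B C0\<close> to \<open>x\<close>.\<close>
    obtain x2 x3 where "distinct [x, x2, x3]"
    proof (cases x)
      case (B c)
      then show thesis using that[of "F 0 True C0" "F 1 True C0"] by simp
    next
      case (F n b c)
      then show thesis using that[of "B C0" "B C1"] by simp
    qed
    then obtain k where k: "k \<in> ?S" "k (B C0) = x" using trans by blast
    let ?c = "\<lambda>g. k \<circ> g \<circ> inv_into UNIV k"
    have kk: "inv_into UNIV k (k v) = v" "k (inv_into UNIV k v) = v" for v using cancel[OF k(1)] by auto
    have kx: "inv_into UNIV k x = B C0" using kk(1)[of "B C0"] k(2) by simp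
    \<comment> \<open>The two products differ at \<open>k (F 0 False C0)\<close>: one gives
      \<open>k (F 1 True C0)\<close>, the other \<open>k (F 3 False C0)\<close>.\<close>
    have "?c flip \<circ> ?c i \<noteq> ?c i \<circ> ?c flip"
    proof
      assume "?c flip \<circ> ?c i = ?c i \<circ> ?c flip"
      then have "(?c flip \<circ> ?c i) (k (F 0 False C0)) = (?c i \<circ> ?c flip) (k (F 0 False C0))" by simp
      then have "k (F 1 True C0) = k (F 3 False C0)" using i by (simp add: kk)
      then have "F 1 True C0 = F 3 False C0" using kk(1) by metis
      then show False by simp
    qed
    moreover have "?c flip \<in> ?S" "?c i \<in> ?S" using conj flip iS k(1) by blast+
    moreover have "?c flip x = x" "?c i x = x" using kx k i by simp_all
    moreover have "?c flip \<circ> ?c flip = id" "?c i \<circ> ?c i = id" using kk ii by (auto simp: fun_eq_iff)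
    ultimately show ?thesis by blast
  qed
  have id: "id \<in> ?S" by (rule dih_S) (simp add: dih_def)
  have distinct: "distinct [B C0, B C1, B C2]" by simp
  interpret involutive_permutations ?S "B C0" "B C1" "B C2"
    by (rule involutive_permutations.intro) (fact bij id comp inverse distinct trans free involution noncomm)+
  show ?thesis using sharply_3_transitive stabilizer_no_abelian_normal by blast
qed

end
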